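(* Let $p \geq 1$ and let $n, n_1,\dots,n_p$ be integers with $0 < n_p < \cdots < n_1 < n$. Let $W$, $\Xi$ and $\Psi=(x_1,\dots,x_p) : \mathbb{C}^p\setminus \Xi \to \mathbb{C}^p$ be as defined in the context. Then: (1) The restriction $\Psi : [0,\infty)^p \to [0,\infty)^p$ is a bijection. (2) The (holomorphic) Jacobian determinant of $\Psi : \mathbb{C}^p\setminus\Xi \to \mathbb{C}^p$ satisfies $$\frac{\partial(x_1,\dots,x_p)}{\partial(\xi_1,\dots,\xi_p)} = \left(1+\sum_{k=1}^p \xi_k\right)^{\frac{n_1+\cdots+n_p}{n}-p-1}\left(1+\frac1n\sum_{k=1}^p n_k\,\xi_k\right).$$ (3) The restriction $\Psi : [0,\infty)^p\to[0,\infty)^p$ and its inverse $\Psi^{-1} : [0,\infty)^p\to[0,\infty)^p$ are analytic. (4) The principal solution of $Z^n + x_1 Z^{n_1}+\cdots+x_pZ^{n_p}-1=0$ is $Z := W^{-\frac1n}\circ\Psi^{-1} : [0,\infty)^p \to (0,1]$.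
   Context: Define $\Xi := \{(\xi_1,\dots,\xi_p)\in\mathbb{C}^p : \xi_1+\cdots+\xi_p \in (-\infty,-1]\}$ and $W(\xi) := 1+\xi_1+\cdots+\xi_p$. Let $W^{\frac1n} : \mathbb{C}^p\setminus\Xi\to\mathbb{C}$ be the holomorphic branch of $\sqrt[n]{W}$ with $W^{\frac1n}(0,\dots,0)=1$; for an integer $m$, $W^{\frac mn}$ means $(W^{\frac1n})^m$. The holomorphic map $\Psi=(x_1,\dots,x_p) : \mathbb{C}^p\setminus\Xi\to\mathbb{C}^p$ is defined by $x_i(\xi) := \xi_i\, W(\xi_1,\dots,\xi_p)^{\frac{n_i}{n}-1}$ for $i=1,\dots,p$. A function is analytic on $[0,\infty)^p$ if near each point of $[0,\infty)^p$ it is given by a convergent power series. A principal solution is an analytic function $Z(x_1,\dots,x_p)$ on $[0,\infty)^p$ satisfying $Z^n + x_1 Z^{n_1}+\cdots+x_pZ^{n_p}-1=0$ for all $(x_1,\dots,x_p)\in[0,\infty)^p$ and $Z(0,\dots,0)=1$ (it is unique if it exists). *)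

theory Defs
  imports "HOL-Analysis.Analysis"
begin

text \<open>
  \<open>\<complex>\<^sup>p\<close> is \<open>complex ^ 'p\<close> for a finite, linearly ordered index type \<open>'p\<close>; the numbers
  \<open>n\<^sub>1, \<dots>, n\<^sub>p\<close> form a function \<open>ns :: 'p \<Rightarrow> nat\<close>.
\<close>

text \<open>
  Holomorphy in several complex variables: the Frechet derivative exists and is
  complex-linear. It is only used on open sets. For a holomorphic map \<open>F\<close> the matrix
  \<open>jacobian F (at z)\<close> of the Frechet derivative has the holomorphic partial derivatives
  as its entries.
\<close>

definition holomorphic_fun_on :: "(complex ^ 'p \<Rightarrow> complex) \<Rightarrow> (complex ^ 'p) set \<Rightarrow> bool"
    (infix \<open>holomorphic'_fun'_on\<close> 50) where
  "f holomorphic_fun_on U \<longleftrightarrow>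
     (\<forall>z\<in>U. \<exists>a. (f has_derivative (\<lambda>v. \<Sum>i\<in>UNIV. a i * v $ i)) (at z within U))"

definition holomorphic_map_on ::
    "(complex ^ 'p \<Rightarrow> complex ^ 'q) \<Rightarrow> (complex ^ 'p) set \<Rightarrow> bool"
    (infix \<open>holomorphic'_map'_on\<close> 50) where
  "F holomorphic_map_on U \<longleftrightarrow> (\<forall>i. (\<lambda>z. F z $ i) holomorphic_fun_on U)"

text \<open>
  Near every point \<open>a\<close> of \<open>S\<close> the function \<open>f\<close> is given on \<open>S\<close> by a power series centred at
  \<open>a\<close> that converges on a full polydisc around \<open>a\<close>. A multi-index is a function \<open>'p \<Rightarrow> nat\<close>.
  If \<open>S\<close> is \<open>[0,\<infinity>)\<^sup>p\<close>, considered as a subset of \<open>\<complex>\<^sup>p\<close>, and \<open>f\<close> is real-valued on \<open>S\<close>, then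
  the coefficients are necessarily real, so that this is real analyticity.
\<close>

definition power_series_analytic_on :: "(complex ^ 'p \<Rightarrow> complex) \<Rightarrow> (complex ^ 'p) set \<Rightarrow> bool"
    (infix \<open>power'_series'_analytic'_on\<close> 50) where
  "f power_series_analytic_on S \<longleftrightarrow>
     (\<forall>a\<in>S. \<exists>r>0. \<exists>c :: ('p \<Rightarrow> nat) \<Rightarrow> complex. \<forall>x. (\<forall>i. norm (x $ i - a $ i) < r) \<longrightarrow>
        (\<lambda>\<alpha>. c \<alpha> * (\<Prod>i\<in>UNIV. (x $ i - a $ i) ^ \<alpha> i)) summable_on UNIV \<and>
        (x \<in> S \<longrightarrow> ((\<lambda>\<alpha>. c \<alpha> * (\<Prod>i\<in>UNIV. (x $ i - a $ i) ^ \<alpha> i)) has_sum f x) UNIV))"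

definition orthant :: "(complex ^ 'p) set" where
  "orthant = {x. \<forall>i. x $ i \<in> \<real>\<^sub>\<ge>\<^sub>0}"

definition Xi :: "(complex ^ 'p) set" where
  "Xi = {\<xi>. (\<Sum>i\<in>UNIV. \<xi> $ i) \<in> complex_of_real ` {..-1}}"

definition W :: "complex ^ 'p \<Rightarrow> complex" where
  "W \<xi> = 1 + (\<Sum>i\<in>UNIV. \<xi> $ i)"

definition is_root_branch :: "nat \<Rightarrow> (complex ^ 'p \<Rightarrow> complex) \<Rightarrow> bool" where
  "is_root_branch n R \<longleftrightarrow>
     R holomorphic_fun_on (- Xi) \<and> (\<forall>\<xi>\<in>- Xi. R \<xi> ^ n = W \<xi>) \<and> R 0 = 1"

text \<open>
  The choice is unique on \<open>- Xi\<close>, see \<open>is_root_branch_W_root\<close> and \<open>is_root_branch_unique\<close>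
  below; the values on \<open>Xi\<close> are irrelevant.
\<close>

definition W_root :: "nat \<Rightarrow> complex ^ 'p \<Rightarrow> complex" where
  "W_root n = (SOME R. is_root_branch n R)"

text \<open>\<open>W_pow n m\<close> is \<open>W\<close> to the power \<open>m/n\<close>.\<close>

definition W_pow :: "nat \<Rightarrow> int \<Rightarrow> complex ^ 'p \<Rightarrow> complex" where
  "W_pow n m \<xi> = W_root n \<xi> powi m"

definition Psi :: "nat \<Rightarrow> ('p \<Rightarrow> nat) \<Rightarrow> complex ^ 'p \<Rightarrow> complex ^ 'p" where
  "Psi n ns \<xi> = (\<chi> i. \<xi> $ i * W_pow n (int (ns i) - int n) \<xi>)"

definition principal_solution ::
    "nat \<Rightarrow> ('p \<Rightarrow> nat) \<Rightarrow> (complex ^ 'p \<Rightarrow> complex) \<Rightarrow> bool" where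
  "principal_solution n ns Z \<longleftrightarrow>
     Z power_series_analytic_on orthant \<and>
     (\<forall>x\<in>orthant. Z x ^ n + (\<Sum>i\<in>UNIV. x $ i * Z x ^ ns i) - 1 = 0) \<and>
     Z 0 = 1"


lemma W_notin_nonpos:
  assumes "\<xi> \<notin> Xi"
  shows "W \<xi> \<notin> \<real>\<^sub>\<le>\<^sub>0"
proof
  assume "W \<xi> \<in> \<real>\<^sub>\<le>\<^sub>0"
  then obtain r where "W \<xi> = complex_of_real r" "r \<le> 0"
    by (auto elim!: nonpos_Reals_cases)
  then have "(\<Sum>i\<in>UNIV. \<xi> $ i) = complex_of_real (r - 1)" "r - 1 \<le> -1"
    by (auto simp: W_def algebra_simps)
  with assms show False
    unfolding Xi_def by blast
qed

lemma starlike_Compl_Xi: "starlike (- Xi :: (complex ^ 'p) set)"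
  unfolding starlike_def
proof (intro bexI ballI subsetI)
  show "(0 :: complex ^ 'p) \<in> - Xi"
    by (auto simp: Xi_def complex_eq_iff)
next
  fix x y :: "complex ^ 'p"
  assume x: "x \<in> - Xi" and "y \<in> closed_segment 0 x"
  then obtain u where u: "0 \<le> u" "u \<le> 1" "y = u *\<^sub>R x"
    by (auto simp: closed_segment_def)
  show "y \<in> - Xi"
  proof
    assume "y \<in> Xi"
    then obtain r where r: "(\<Sum>i\<in>UNIV. y $ i) = complex_of_real r" "r \<le> -1"
      by (auto simp: Xi_def)
    have "(\<Sum>i\<in>UNIV. y $ i) = of_real u * (\<Sum>i\<in>UNIV. x $ i)"
      unfolding u(3) vector_scaleR_component by (simp add: sum_distrib_left scaleR_conv_of_real)
    with r have eq: "of_real u * (\<Sum>i\<in>UNIV. x $ i) = complex_of_real r"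
      by simp
    with r u have "u > 0"
      by (cases "u = 0") auto
    with eq have "(\<Sum>i\<in>UNIV. x $ i) = complex_of_real (r / u)"
      by (simp add: field_simps)
    moreover have "r / u \<le> -1"
      using r u \<open>u > 0\<close> by (simp add: field_simps)
    ultimately show False
      using x unfolding Xi_def by blast
  qed
qed

lemma is_root_branch_powr:
  assumes "n > 0"
  shows "is_root_branch n (\<lambda>\<xi> :: complex ^ 'p. W \<xi> powr (1 / of_nat n))"
  unfolding is_root_branch_def
proof (intro conjI ballI)
  show "(\<lambda>\<xi> :: complex ^ 'p. W \<xi> powr (1 / of_nat n)) holomorphic_fun_on - Xi"
    unfolding holomorphic_fun_on_def
  proof
    fix z :: "complex ^ 'p"
    assume "z \<in> - Xi"
    then have "W z \<notin> \<real>\<^sub>\<le>\<^sub>0"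
      using W_notin_nonpos by blast
    then have d: "((\<lambda>w. w powr (1 / of_nat n)) has_field_derivative
        1 / of_nat n * W z powr (1 / of_nat n - 1)) (at (W z))"
      by (rule has_field_derivative_powr)
    have "(W has_derivative (\<lambda>v. \<Sum>i\<in>UNIV. v $ i)) (at z within - Xi)"
      unfolding W_def
      by (auto intro!: derivative_eq_intros bounded_linear.has_derivative[OF bounded_linear_vec_nth])
    from has_derivative_compose[OF this d[unfolded has_field_derivative_def]]
    have "((\<lambda>\<xi>. W \<xi> powr (1 / of_nat n)) has_derivative
        (\<lambda>v. \<Sum>i\<in>UNIV. (1 / of_nat n * W z powr (1 / of_nat n - 1)) * v $ i)) (at z within - Xi)"
      by (simp add: sum_distrib_left)
    then show "\<exists>a. ((\<lambda>\<xi>. W \<xi> powr (1 / of_nat n)) has_derivative (\<lambda>v. \<Sum>i\<in>UNIV. a i * v $ i))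
        (at z within - Xi)"
      by (intro exI[of _ "\<lambda>_. 1 / of_nat n * W z powr (1 / of_nat n - 1)"])
  qed
next
  fix \<xi> :: "complex ^ 'p"
  assume "\<xi> \<in> - Xi"
  then have "W \<xi> \<noteq> 0"
    using W_notin_nonpos by force
  then show "(W \<xi> powr (1 / of_nat n)) ^ n = W \<xi>"
    using assms by (simp add: powr_def flip: exp_of_nat_mult)
next
  show "W (0 :: complex ^ 'p) powr (1 / of_nat n) = 1"
    by (simp add: W_def)
qed

lemma is_root_branch_W_root:
  assumes "n > 0"
  shows "is_root_branch n (W_root n)"
  unfolding W_root_def
  using someI[of "is_root_branch n", OF is_root_branch_powr[OF assms]] .

lemma is_root_branch_unique:
  fixes R S :: "complex ^ 'p \<Rightarrow> complex"
  assumes n: "n > 0" and R: "is_root_branch n R" and S: "is_root_branch n S"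
    and \<xi>: "\<xi> \<notin> Xi"
  shows "R \<xi> = S \<xi>"
proof -
  have cont: "continuous_on (- Xi) f" if "is_root_branch n f" for f :: "complex ^ 'p \<Rightarrow> complex"
    unfolding continuous_on_eq_continuous_within
    using that has_derivative_continuous
    unfolding is_root_branch_def holomorphic_fun_on_def by blast
  have W0: "W z \<noteq> 0" if "z \<in> - Xi" for z :: "complex ^ 'p"
    using W_notin_nonpos[of z] that by force
  have S0: "S z \<noteq> 0" if "z \<in> - Xi" for z
    using W0[OF that] S that n unfolding is_root_branch_def by (metis power_eq_0_iff)
  have c: "continuous_on (- Xi) (\<lambda>z. R z / S z)"
    using cont[OF R] cont[OF S] S0 by (intro continuous_on_divide) auto
  have "(\<lambda>z. R z / S z) ` (- Xi) \<subseteq> {w. w ^ n = 1}"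
    using R S W0 by (auto simp: is_root_branch_def power_divide)
  moreover have "finite {w :: complex. w ^ n = 1}"
    using n by (intro finite_roots_unity) auto
  ultimately have "finite ((\<lambda>z. R z / S z) ` (- Xi))"
    by (rule finite_subset)
  then have "(\<lambda>z. R z / S z) constant_on (- Xi)"
    using continuous_finite_range_constant[OF starlike_imp_connected[OF starlike_Compl_Xi] c]
    by simp
  then obtain k where k: "\<And>z. z \<in> - Xi \<Longrightarrow> R z / S z = k"
    unfolding constant_on_def by blast
  have "(0 :: complex ^ 'p) \<in> - Xi"
    by (auto simp: Xi_def complex_eq_iff)
  from k[OF this] have "k = 1"
    using R S by (simp add: is_root_branch_def)
  with k[of \<xi>] S0[of \<xi>] \<xi> show ?thesis
    by simp
qed

end

theory Submission
  imports Defs "HOL-Complex_Analysis.Cauchy_Integral_Formula"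
begin

text \<open>
  Everything rests on one observation. If \<open>\<xi>\<close> lies in the orthant, \<open>s = W(\<xi>)\<^sup>1\<^sup>/\<^sup>n \<ge> 1\<close> and
  \<open>x = \<Psi>(\<xi>)\<close>, then \<open>z = 1/s\<close> satisfies \<open>z^n + \<Sum> x\<^sub>i z^(n\<^sub>i) = (1 + \<Sum> \<xi>\<^sub>i) / s^n = 1\<close>. Conversely
  the left-hand side increases from \<open>0\<close> to at least \<open>1\<close> on \<open>[0,1]\<close>, so for every \<open>x\<close> in the
  orthant there is exactly one positive root \<open>z\<close>, it lies in \<open>(0,1]\<close>, and
  \<open>\<xi>\<^sub>i = x\<^sub>i / z^(n - n\<^sub>i)\<close> is the unique preimage of \<open>x\<close> (\<open>bij_betw_Psi\<close>). Hence
  \<open>W\<^sup>-\<^sup>1\<^sup>/\<^sup>n \<circ> \<Psi>\<^sup>-\<^sup>1\<close> is the positive root, and the analyticity of \<open>\<Psi>\<^sup>-\<^sup>1\<close> and of the principal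
  solution reduces to that of \<open>\<phi>(z)\<close>, as a function of \<open>x\<close>, for \<open>\<phi>\<close> holomorphic in the right
  half-plane.

  Power series in several variables are produced by a single device. For \<open>A\<close> and \<open>B\<^sub>i\<close>
  continuous on a circle, the integral of \<open>A(y) / (1 - \<Sum> h\<^sub>i B\<^sub>i(y))\<close> over the circle is a power
  series in \<open>h\<close>: expand the geometric series into a sum over words in the index set and
  integrate term by term (\<open>has_power_series_at_circle_integral\<close>). Both kinds of functions that
  occur have such a representation. A holomorphic function of \<open>W\<close> is the Cauchy integral of
  \<open>f(y) / (y - W(x))\<close>, and \<open>y - W(x)\<close> is affine in \<open>x\<close>. With \<open>F(x,y)\<close> for the polynomial
  \<open>y^n + \<Sum> x\<^sub>i y^(n\<^sub>i) - 1\<close>, the value \<open>\<phi>(z)\<close> at the positive root is \<open>1/(2\<pi>i)\<close> times the integral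
  of \<open>\<phi>(y) F\<^sub>y(x,y) / F(x,y)\<close> around a small circle, and here \<open>F\<close> and \<open>F\<^sub>y\<close> are affine in \<open>x\<close>
  (\<open>has_power_series_at_pos_root\<close>). This replaces an inverse function theorem.

  The polynomial factors as \<open>F(x,y) = (y - z) Q(x,y,z)\<close> at a root \<open>z\<close>, with an explicit
  polynomial \<open>Q\<close> that is positive at positive arguments. So the positive root is simple and
  depends continuously on \<open>x\<close>. A second analytic solution can leave the positive root only by
  jumping to a zero of \<open>Q\<close>, which its continuity on the connected orthant forbids
  (\<open>principal_solution_unique\<close>).

  The Jacobian matrix is a diagonal matrix times a rank-one perturbation of the identity, and
  its determinant follows from \<open>det (1 + u w\<^sup>T) = 1 + \<Sum> u\<^sub>i w\<^sub>i\<close>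
  (\<open>det_identity_plus_rank_one\<close>).
\<close>

section \<open>The geometric series over words\<close>

text \<open>
  A word over the index set is a product of variables in which the order matters. Words take
  the place of multi-indices here: expanding a power of a sum into words needs no multinomial
  coefficients, and these reappear only when words with equal letter counts are collected.
\<close>

lemma sum_words_length:
  fixes t :: "'a :: finite \<Rightarrow> 'b :: comm_semiring_1"
  shows "(\<Sum>w | length w = k. \<Prod>i\<leftarrow>w. t i) = (\<Sum>i\<in>UNIV. t i) ^ k"
proof (induction k)
  case (Suc k)
  have "{w :: 'a list. length w = Suc k} = (\<lambda>(i, w). i # w) ` (UNIV \<times> {w. length w = k})"
    by (auto simp: image_iff length_Suc_conv)
  moreover have "inj_on (\<lambda>(i :: 'a, w). i # w) (UNIV \<times> {w. length w = k})"
    by (auto simp: inj_on_def)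
  ultimately have "(\<Sum>w | length w = Suc k. \<Prod>i\<leftarrow>w. t i)
      = (\<Sum>(i, w)\<in>UNIV \<times> {w. length w = k}. t i * (\<Prod>i\<leftarrow>w. t i))"
    by (simp add: sum.reindex case_prod_unfold)
  also have "\<dots> = (\<Sum>i\<in>UNIV. t i) * (\<Sum>w | length w = k. \<Prod>i\<leftarrow>w. t i)"
    by (simp add: sum_product sum.cartesian_product)
  finally show ?case
    using Suc by simp
qed simp

lemma finite_words_length: "finite {w :: 'a :: finite list. length w = k}"
  using finite_lists_length_eq[of "UNIV :: 'a set" k] by simp

lemma norm_prod_list_map: "norm (\<Prod>i\<leftarrow>w. t i) = (\<Prod>i\<leftarrow>w. norm (t i))"
  for t :: "'a \<Rightarrow> 'b :: real_normed_field"
  by (induction w) (auto simp: norm_mult)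

lemma has_sum_fibres:
  "((\<lambda>(k, w). f w) has_sum S) (SIGMA k:UNIV. {w. g w = k}) \<longleftrightarrow> (f has_sum S) UNIV"
proof -
  have "bij_betw snd (SIGMA k:UNIV. {w. g w = k}) UNIV"
    by (rule bij_betw_byWitness[where f' = "\<lambda>w. (g w, w)"]) auto
  from has_sum_reindex_bij_betw[OF this, of f S] show ?thesis
    by (simp add: case_prod_unfold)
qed

lemma summable_words:
  fixes t :: "'a :: finite \<Rightarrow> real"
  assumes "\<And>i. 0 \<le> t i" "(\<Sum>i\<in>UNIV. t i) < 1"
  shows "(\<lambda>w. \<Prod>i\<leftarrow>w. t i) summable_on UNIV"
proof -
  have nn: "0 \<le> (\<Prod>i\<leftarrow>w. t i)" for w
    using assms(1) by (induction w) auto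
  have s: "((\<lambda>w. \<Prod>i\<leftarrow>w. t i) has_sum (\<Sum>i\<in>UNIV. t i) ^ k) {w. length w = k}" for k
    using has_sum_finite[OF finite_words_length[of k], where f = "\<lambda>w. \<Prod>i\<leftarrow>w. t i"]
      sum_words_length[of t k] by simp
  have "norm (\<Sum>i\<in>UNIV. t i) < 1"
    using assms by (simp add: sum_nonneg)
  then have "summable (\<lambda>k. norm ((\<Sum>i\<in>UNIV. t i) ^ k))"
    unfolding norm_power by (intro summable_geometric) simp
  then have "(\<lambda>k. (\<Sum>i\<in>UNIV. t i) ^ k) summable_on UNIV"
    by (rule norm_summable_imp_summable_on)
  then have "(\<lambda>(k, w). \<Prod>i\<leftarrow>w. t i) summable_on (SIGMA k:UNIV. {w. length w = k})"
    using s nn by (intro summable_on_SigmaI[where g = "\<lambda>k. (\<Sum>i\<in>UNIV. t i) ^ k"]) auto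
  then show ?thesis
    unfolding summable_on_def has_sum_fibres .
qed

lemma has_sum_words:
  fixes t :: "'a :: finite \<Rightarrow> complex"
  assumes "(\<Sum>i\<in>UNIV. norm (t i)) < 1"
  shows "((\<lambda>w. \<Prod>i\<leftarrow>w. t i) has_sum 1 / (1 - (\<Sum>i\<in>UNIV. t i))) UNIV"
proof -
  have s: "((\<lambda>w. \<Prod>i\<leftarrow>w. t i) has_sum (\<Sum>i\<in>UNIV. t i) ^ k) {w. length w = k}" for k
    using has_sum_finite[OF finite_words_length[of k], where f = "\<lambda>w. \<Prod>i\<leftarrow>w. t i"]
      sum_words_length[of t k] by simp
  have "(\<lambda>w. norm (\<Prod>i\<leftarrow>w. t i)) summable_on UNIV"
    unfolding norm_prod_list_map using assms by (intro summable_words) auto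
  then have "(\<lambda>w. \<Prod>i\<leftarrow>w. t i) summable_on UNIV"
    by (rule abs_summable_summable)
  then obtain S where S: "((\<lambda>w. \<Prod>i\<leftarrow>w. t i) has_sum S) UNIV"
    by (auto simp: summable_on_def)
  then have "((\<lambda>(k, w). \<Prod>i\<leftarrow>w. t i) has_sum S) (SIGMA k:UNIV. {w. length w = k})"
    unfolding has_sum_fibres .
  then have "((\<lambda>k. (\<Sum>i\<in>UNIV. t i) ^ k) has_sum S) UNIV"
    by (rule has_sum_SigmaD)
      (use s in auto)
  then have "(\<lambda>k. (\<Sum>i\<in>UNIV. t i) ^ k) sums S"
    by (rule has_sum_imp_sums)
  moreover have "norm (\<Sum>i\<in>UNIV. t i) < 1"
    using assms norm_sum[of t UNIV] by linarith
  ultimately show ?thesis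
    using S geometric_sums[of "\<Sum>i\<in>UNIV. t i"] sums_unique2 by blast
qed

lemma prod_list_count:
  fixes t :: "'a :: finite \<Rightarrow> 'b :: comm_monoid_mult"
  shows "(\<Prod>i\<leftarrow>w. t i) = (\<Prod>i\<in>UNIV. t i ^ count_list w i)"
proof (induction w)
  case (Cons a w)
  have "(\<Prod>i\<in>UNIV. t i ^ count_list (a # w) i)
      = (\<Prod>i\<in>UNIV. (if i = a then t i else 1) * t i ^ count_list w i)"
    by (intro prod.cong) auto
  then show ?case
    using Cons by (simp add: prod.distrib)
qed simp

section \<open>Functions given by a power series on a polydisc\<close>

definition polydisc :: "complex ^ 'p \<Rightarrow> real \<Rightarrow> (complex ^ 'p) set" where
  "polydisc a r = {x. \<forall>i. norm (x $ i - a $ i) < r}"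

definition power_series_sums ::
    "(('p \<Rightarrow> nat) \<Rightarrow> complex) \<Rightarrow> complex ^ 'p \<Rightarrow> real \<Rightarrow> (complex ^ 'p \<Rightarrow> complex) \<Rightarrow> bool" where
  "power_series_sums c a r f \<longleftrightarrow> (\<forall>x\<in>polydisc a r.
     ((\<lambda>\<alpha>. c \<alpha> * (\<Prod>i\<in>UNIV. (x $ i - a $ i) ^ \<alpha> i)) has_sum f x) UNIV)"

definition has_power_series_at ::
    "(complex ^ 'p \<Rightarrow> complex) \<Rightarrow> complex ^ 'p \<Rightarrow> real \<Rightarrow> bool" where
  "has_power_series_at f a r \<longleftrightarrow> (\<exists>c. power_series_sums c a r f)"

lemma polydisc_mono: "s \<le> r \<Longrightarrow> polydisc a s \<subseteq> polydisc a r"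
  unfolding polydisc_def by (auto intro: order_less_le_trans)

text \<open>
  A word series becomes a power series when the finitely many words with the same letter counts
  are collected. Summability over all words makes this regrouping legitimate.
\<close>

lemma has_power_series_at_words:
  fixes a :: "complex ^ 'p :: finite"
  assumes "\<And>x. x \<in> polydisc a r \<Longrightarrow>
     ((\<lambda>w. C w * (\<Prod>i\<leftarrow>w. x $ i - a $ i)) has_sum f x) UNIV"
  shows "has_power_series_at f a r"
proof -
  define N where "N \<alpha> = {w :: 'p list. count_list w = \<alpha>}" for \<alpha>
  have fin: "finite (N \<alpha>)" for \<alpha>
  proof (rule finite_subset)
    show "N \<alpha> \<subseteq> {w. length w = sum \<alpha> UNIV}"
      unfolding N_def by (auto simp: sum_count_set[of _ UNIV])
    show "finite {w :: 'p list. length w = sum \<alpha> UNIV}"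
      by (rule finite_words_length)
  qed
  define c where "c \<alpha> = (\<Sum>w\<in>N \<alpha>. C w)" for \<alpha>
  have "((\<lambda>\<alpha>. c \<alpha> * (\<Prod>i\<in>UNIV. (x $ i - a $ i) ^ \<alpha> i)) has_sum f x) UNIV"
    if x: "x \<in> polydisc a r" for x
  proof -
    define h where "h i = x $ i - a $ i" for i
    have fibre: "((\<lambda>w. C w * (\<Prod>i\<leftarrow>w. h i)) has_sum c \<alpha> * (\<Prod>i\<in>UNIV. h i ^ \<alpha> i)) (N \<alpha>)" for \<alpha>
    proof -
      have "(\<Sum>w\<in>N \<alpha>. C w * (\<Prod>i\<leftarrow>w. h i)) = c \<alpha> * (\<Prod>i\<in>UNIV. h i ^ \<alpha> i)"
        unfolding c_def sum_distrib_right by (intro sum.cong) (auto simp: N_def prod_list_count)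
      from has_sum_finite[OF fin[of \<alpha>], where f = "\<lambda>w. C w * (\<Prod>i\<leftarrow>w. h i)", unfolded this]
      show ?thesis .
    qed
    have "((\<lambda>w. C w * (\<Prod>i\<leftarrow>w. h i)) has_sum f x) UNIV"
      using assms[OF x] unfolding h_def .
    then have "((\<lambda>(\<alpha>, w). C w * (\<Prod>i\<leftarrow>w. h i)) has_sum f x) (Sigma UNIV N)"
      unfolding N_def has_sum_fibres .
    then have "((\<lambda>\<alpha>. c \<alpha> * (\<Prod>i\<in>UNIV. h i ^ \<alpha> i)) has_sum f x) UNIV"
      by (rule has_sum_SigmaD) (use fibre in auto)
    then show ?thesis
      unfolding h_def .
  qed
  then show ?thesis
    unfolding has_power_series_at_def power_series_sums_def by blast
qed

lemma has_power_series_at_mono: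
  assumes "has_power_series_at f a r" "s \<le> r"
  shows "has_power_series_at f a s"
proof -
  obtain c where "power_series_sums c a r f"
    using assms(1) unfolding has_power_series_at_def by auto
  then have "power_series_sums c a s f"
    unfolding power_series_sums_def using polydisc_mono[OF assms(2), of a] by auto
  then show ?thesis
    unfolding has_power_series_at_def by auto
qed

lemma has_power_series_at_add:
  assumes "has_power_series_at f a r" "has_power_series_at g a r"
  shows "has_power_series_at (\<lambda>x. f x + g x) a r"
proof -
  obtain c where c: "power_series_sums c a r f"
    using assms(1) unfolding has_power_series_at_def by blast
  obtain d where d: "power_series_sums d a r g"
    using assms(2) unfolding has_power_series_at_def by blast
  show ?thesis
    unfolding has_power_series_at_def power_series_sums_def
  proof (intro exI[of _ "\<lambda>\<alpha>. c \<alpha> + d \<alpha>"] ballI)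
    fix x assume x: "x \<in> polydisc a r"
    show "((\<lambda>\<alpha>. (c \<alpha> + d \<alpha>) * (\<Prod>i\<in>UNIV. (x $ i - a $ i) ^ \<alpha> i)) has_sum f x + g x) UNIV"
      using has_sum_add[OF c[unfolded power_series_sums_def, rule_format, OF x]
          d[unfolded power_series_sums_def, rule_format, OF x]]
      by (simp add: ring_distribs)
  qed
qed

lemma has_power_series_at_cmult:
  assumes "has_power_series_at f a r"
  shows "has_power_series_at (\<lambda>x. k * f x) a r"
proof -
  obtain c where c: "power_series_sums c a r f"
    using assms(1) unfolding has_power_series_at_def by blast
  show ?thesis
    unfolding has_power_series_at_def power_series_sums_def
  proof (intro exI[of _ "\<lambda>\<alpha>. k * c \<alpha>"] ballI)
    fix x assume x: "x \<in> polydisc a r"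
    show "((\<lambda>\<alpha>. k * c \<alpha> * (\<Prod>i\<in>UNIV. (x $ i - a $ i) ^ \<alpha> i)) has_sum k * f x) UNIV"
      using has_sum_cmult_right[OF c[unfolded power_series_sums_def, rule_format, OF x], of k]
      by (simp add: mult.assoc)
  qed
qed

lemma has_power_series_at_0: "has_power_series_at (\<lambda>x. 0) a r"
  unfolding has_power_series_at_def power_series_sums_def by (intro exI[of _ "\<lambda>_. 0"]) auto

lemma has_power_series_at_sum:
  assumes "\<And>i. i \<in> I \<Longrightarrow> has_power_series_at (f i) a r"
  shows "has_power_series_at (\<lambda>x. \<Sum>i\<in>I. f i x) a r"
  using assms
  by (induction I rule: infinite_finite_induct)
    (auto intro: has_power_series_at_add has_power_series_at_0)

text \<open>
  Since \<open>x\<^sub>j = (x\<^sub>j - a\<^sub>j) + a\<^sub>j\<close>, it is enough to multiply by \<open>x\<^sub>j - a\<^sub>j\<close>, which shifts the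
  coefficients by one in direction \<open>j\<close>.
\<close>

lemma has_power_series_at_mult_coord:
  fixes a :: "complex ^ 'p :: finite"
  assumes "has_power_series_at f a r"
  shows "has_power_series_at (\<lambda>x. x $ j * f x) a r"
proof -
  obtain c where c: "power_series_sums c a r f"
    using assms(1) unfolding has_power_series_at_def by blast
  define up :: "('p \<Rightarrow> nat) \<Rightarrow> 'p \<Rightarrow> nat" where "up \<alpha> = \<alpha>(j := Suc (\<alpha> j))" for \<alpha>
  define d where "d \<alpha> = (if \<alpha> j = 0 then 0 else c (\<alpha>(j := \<alpha> j - 1)))" for \<alpha>
  have "has_power_series_at (\<lambda>x. (x $ j - a $ j) * f x) a r"
    unfolding has_power_series_at_def power_series_sums_def
  proof (intro exI[of _ d] ballI)
    fix x assume x: "x \<in> polydisc a r"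
    define h where "h i = x $ i - a $ i" for i
    have split: "(\<Prod>i\<in>UNIV. h i ^ \<alpha> i) = h j ^ \<alpha> j * (\<Prod>i\<in>UNIV - {j}. h i ^ \<alpha> i)" for \<alpha>
      by (simp add: prod.remove)
    have "(\<Prod>i\<in>UNIV. h i ^ up \<alpha> i) = h j * (\<Prod>i\<in>UNIV. h i ^ \<alpha> i)" for \<alpha>
      unfolding split by (simp add: up_def)
    moreover have "d (up \<alpha>) = c \<alpha>" for \<alpha>
      by (simp add: d_def up_def)
    moreover have "((\<lambda>\<alpha>. h j * (c \<alpha> * (\<Prod>i\<in>UNIV. h i ^ \<alpha> i))) has_sum h j * f x) UNIV"
      using c x unfolding h_def power_series_sums_def by (intro has_sum_cmult_right) auto
    ultimately have "(((\<lambda>\<alpha>. d \<alpha> * (\<Prod>i\<in>UNIV. h i ^ \<alpha> i)) \<circ> up) has_sum h j * f x) UNIV"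
      by (simp add: o_def mult.left_commute)
    moreover have "inj up"
      by (rule inj_on_inverseI[of _ "\<lambda>\<alpha>. \<alpha>(j := \<alpha> j - 1)"]) (auto simp: up_def)
    ultimately have "((\<lambda>\<alpha>. d \<alpha> * (\<Prod>i\<in>UNIV. h i ^ \<alpha> i)) has_sum h j * f x) (range up)"
      by (simp add: has_sum_reindex)
    moreover have "d \<alpha> = 0" if "\<alpha> \<notin> range up" for \<alpha>
    proof (rule ccontr)
      assume "d \<alpha> \<noteq> 0"
      then have "\<alpha> = up (\<alpha>(j := \<alpha> j - 1))"
        by (auto simp: d_def up_def split: if_splits)
      with that show False by blast
    qed
    ultimately have "((\<lambda>\<alpha>. d \<alpha> * (\<Prod>i\<in>UNIV. h i ^ \<alpha> i)) has_sum h j * f x) UNIV"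
      by (subst has_sum_cong_neutral[of "range up"]) auto
    then show "((\<lambda>\<alpha>. d \<alpha> * (\<Prod>i\<in>UNIV. (x $ i - a $ i) ^ \<alpha> i)) has_sum (x $ j - a $ j) * f x) UNIV"
      by (simp add: h_def)
  qed
  from has_power_series_at_add[OF this has_power_series_at_cmult[OF assms, of "a $ j"]]
  show ?thesis
    by (simp add: algebra_simps)
qed

text \<open>
  On a polydisc so small that \<open>\<Sum> \<bar>x\<^sub>i - a\<^sub>i\<bar> sup \<bar>B\<^sub>i\<bar> < 1\<close> the integrand is the sum of the words in
  \<open>(x\<^sub>i - a\<^sub>i) B\<^sub>i(y)\<close>, uniformly on the circle, so that the integral may be taken word by word.
  This is the only source of power series in what follows.
\<close>

lemma has_power_series_at_circle_integral:
  fixes a :: "complex ^ 'p :: finite"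
  assumes "0 < \<rho>" and A: "continuous_on (sphere z \<rho>) A"
    and B: "\<And>i. continuous_on (sphere z \<rho>) (B i)"
  shows "\<exists>r>0. has_power_series_at (\<lambda>x. contour_integral (circlepath z \<rho>)
           (\<lambda>y. A y / (1 - (\<Sum>i\<in>UNIV. (x $ i - a $ i) * B i y)))) a r"
proof -
  have bdd: "\<exists>M. \<forall>y\<in>sphere z \<rho>. norm (f y) \<le> M" if "continuous_on (sphere z \<rho>) f"
    for f :: "complex \<Rightarrow> complex"
    using compact_imp_bounded[OF compact_continuous_image[OF that compact_sphere]]
    unfolding bounded_iff by auto
  obtain M where M: "\<And>y. y \<in> sphere z \<rho> \<Longrightarrow> norm (A y) \<le> M"
    using bdd[OF A] by blast
  have "\<exists>K. \<forall>i. \<forall>y\<in>sphere z \<rho>. norm (B i y) \<le> K i"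
    using bdd[OF B] by metis
  then obtain K' where K': "\<And>i y. y \<in> sphere z \<rho> \<Longrightarrow> norm (B i y) \<le> K' i"
    by blast
  define K where "K = 1 + (\<Sum>i\<in>UNIV. \<bar>K' i\<bar>)"
  have "K > 0"
    unfolding K_def by (intro add_pos_nonneg sum_nonneg) auto
  have K: "norm (B i y) \<le> K" if "y \<in> sphere z \<rho>" for i y
  proof -
    have "\<bar>K' i\<bar> \<le> (\<Sum>i\<in>UNIV. \<bar>K' i\<bar>)"
      by (rule member_le_sum) auto
    with K'[OF that, of i] show ?thesis
      unfolding K_def by linarith
  qed
  define r where "r = 1 / (of_nat CARD('p) * K)"
  have "r > 0"
    using \<open>K > 0\<close> by (simp add: r_def)
  define C where "C w = contour_integral (circlepath z \<rho>) (\<lambda>y. A y * (\<Prod>i\<leftarrow>w. B i y))" for w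
  have contP: "continuous_on (sphere z \<rho>) (\<lambda>y. A y * (\<Prod>i\<leftarrow>w. B i y))" for w
  proof -
    have "continuous_on (sphere z \<rho>) (\<lambda>y. \<Prod>i\<leftarrow>w. B i y)"
      by (induction w) (auto intro!: continuous_intros B)
    then show ?thesis
      by (intro continuous_intros A)
  qed
  have int: "(\<lambda>y. A y * (\<Prod>i\<leftarrow>w. B i y)) contour_integrable_on circlepath z \<rho>" for w
    using contP[of w] \<open>0 < \<rho>\<close> by (intro contour_integrable_continuous_circlepath) auto
  have "has_power_series_at (\<lambda>x. contour_integral (circlepath z \<rho>)
           (\<lambda>y. A y / (1 - (\<Sum>i\<in>UNIV. (x $ i - a $ i) * B i y)))) a r"
  proof (rule has_power_series_at_words)
    fix x :: "complex ^ 'p"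
    define h where "h i = x $ i - a $ i" for i
    assume "x \<in> polydisc a r"
    then have "norm (h i) < r" for i
      by (simp add: polydisc_def h_def)
    then have "norm (h i) * K < 1 / of_nat CARD('p)" for i
      using \<open>K > 0\<close> by (simp add: r_def pos_less_divide_eq divide_simps mult.assoc)
        (simp add: algebra_simps)
    then have "(\<Sum>i\<in>UNIV. norm (h i) * K) < (\<Sum>i\<in>(UNIV :: 'p set). 1 / of_nat CARD('p))"
      by (intro sum_strict_mono) auto
    then have lt1: "(\<Sum>i\<in>UNIV. norm (h i) * K) < 1"
      by simp
    define S where "S y = A y / (1 - (\<Sum>i\<in>UNIV. h i * B i y))" for y
    define T where "T w y = A y * (\<Prod>i\<leftarrow>w. h i * B i y)" for w y
    have T: "T w y = (A y * (\<Prod>i\<leftarrow>w. B i y)) * (\<Prod>i\<leftarrow>w. h i)" for w y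
      unfolding T_def by (induction w) (auto simp: algebra_simps)
    have le: "norm (h i * B i y) \<le> norm (h i) * K" if "y \<in> sphere z \<rho>" for i y
      using K[OF that] by (simp add: norm_mult mult_left_mono)
    have "uniform_limit (sphere z \<rho>) (\<lambda>X y. \<Sum>w\<in>X. T w y) S (finite_subsets_at_top UNIV)"
    proof (rule Weierstrass_m_test_general')
      fix y w assume y: "y \<in> sphere z \<rho>"
      have "(\<Prod>i\<leftarrow>w. norm (h i * B i y)) \<le> (\<Prod>i\<leftarrow>w. norm (h i) * K)"
        using le[OF y] \<open>K > 0\<close> by (induction w) (auto intro!: mult_mono prod_list_nonneg)
      moreover have "0 \<le> M"
        using M[OF y] norm_ge_zero order_trans by blast
      ultimately show "norm (T w y) \<le> M * (\<Prod>i\<leftarrow>w. norm (h i) * K)"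
        unfolding T_def norm_mult[of "A y"] norm_prod_list_map
        by (intro mult_mono M[OF y] prod_list_nonneg) auto
    next
      show "(\<lambda>w. M * (\<Prod>i\<leftarrow>w. norm (h i) * K)) summable_on UNIV"
        using lt1 \<open>K > 0\<close> by (intro summable_on_cmult_right summable_words) auto
    next
      fix y assume y: "y \<in> sphere z \<rho>"
      have "(\<Sum>i\<in>UNIV. norm (h i * B i y)) \<le> (\<Sum>i\<in>UNIV. norm (h i) * K)"
        by (intro sum_mono le[OF y])
      with lt1 have "((\<lambda>w. \<Prod>i\<leftarrow>w. h i * B i y) has_sum 1 / (1 - (\<Sum>i\<in>UNIV. h i * B i y))) UNIV"
        by (intro has_sum_words) linarith
      from has_sum_cmult_right[OF this, of "A y"] show "((\<lambda>w. T w y) has_sum S y) UNIV"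
        by (simp add: T_def S_def)
    qed
    note ul = this
    have intT: "T w contour_integrable_on circlepath z \<rho>" for w
      unfolding T by (intro contour_integrable_rmul int)
    have "\<forall>\<^sub>F X in finite_subsets_at_top UNIV.
        (\<lambda>y. \<Sum>w\<in>X. T w y) contour_integrable_on circlepath z \<rho>"
      by (intro eventually_finite_subsets_at_top_weakI contour_integrable_sum intT)
    from contour_integral_uniform_limit_circlepath(2)[OF this ul _ \<open>0 < \<rho>\<close>]
    have "((\<lambda>X. contour_integral (circlepath z \<rho>) (\<lambda>y. \<Sum>w\<in>X. T w y))
        \<longlongrightarrow> contour_integral (circlepath z \<rho>) S) (finite_subsets_at_top UNIV)"
      by simp
    moreover have "contour_integral (circlepath z \<rho>) (\<lambda>y. \<Sum>w\<in>X. T w y)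
        = (\<Sum>w\<in>X. C w * (\<Prod>i\<leftarrow>w. h i))" if "finite X" for X
      using that intT int
      by (simp add: contour_integral_sum) (simp add: T C_def contour_integral_rmul)
    then have eq: "\<forall>\<^sub>F X in finite_subsets_at_top UNIV. contour_integral (circlepath z \<rho>) (\<lambda>y. \<Sum>w\<in>X. T w y)
        = (\<Sum>w\<in>X. C w * (\<Prod>i\<leftarrow>w. h i))"
      by (intro eventually_finite_subsets_at_top_weakI) auto
    ultimately have "((\<lambda>w. C w * (\<Prod>i\<leftarrow>w. h i)) has_sum contour_integral (circlepath z \<rho>) S) UNIV"
      unfolding has_sum_def using tendsto_cong[OF eq] by simp
    then show "((\<lambda>w. C w * (\<Prod>i\<leftarrow>w. x $ i - a $ i)) has_sum contour_integral (circlepath z \<rho>)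
           (\<lambda>y. A y / (1 - (\<Sum>i\<in>UNIV. (x $ i - a $ i) * B i y)))) UNIV"
      unfolding S_def h_def .
  qed
  with \<open>r > 0\<close> show ?thesis
    by blast
qed

lemma power_series_analytic_on_iff:
  "f power_series_analytic_on S \<longleftrightarrow> (\<forall>a\<in>S. \<exists>r>0. \<exists>c. \<forall>x\<in>polydisc a r.
     (\<lambda>\<alpha>. c \<alpha> * (\<Prod>i\<in>UNIV. (x $ i - a $ i) ^ \<alpha> i)) summable_on UNIV \<and>
     (x \<in> S \<longrightarrow> ((\<lambda>\<alpha>. c \<alpha> * (\<Prod>i\<in>UNIV. (x $ i - a $ i) ^ \<alpha> i)) has_sum f x) UNIV))"
  by (simp add: power_series_analytic_on_def polydisc_def)

text \<open>
  The series has to converge on a full polydisc. So \<open>g\<close> is a formula that makes sense at all nearby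
  complex points, such as a circle integral, while \<open>f\<close> is only described on \<open>S\<close>.
\<close>

lemma power_series_analytic_onI:
  assumes "\<And>a. a \<in> S \<Longrightarrow> \<exists>g r. r > 0 \<and> has_power_series_at g a r \<and>
     (\<forall>x\<in>S \<inter> polydisc a r. f x = g x)"
  shows "f power_series_analytic_on S"
  unfolding power_series_analytic_on_iff
proof
  fix a assume "a \<in> S"
  then obtain g r c where r: "r > 0" and c: "power_series_sums c a r g"
    and eq: "\<forall>x\<in>S \<inter> polydisc a r. f x = g x"
    using assms[of a] unfolding has_power_series_at_def by blast
  show "\<exists>r>0. \<exists>c. \<forall>x\<in>polydisc a r.
        (\<lambda>\<alpha>. c \<alpha> * (\<Prod>i\<in>UNIV. (x $ i - a $ i) ^ \<alpha> i)) summable_on UNIV \<and>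
        (x \<in> S \<longrightarrow> ((\<lambda>\<alpha>. c \<alpha> * (\<Prod>i\<in>UNIV. (x $ i - a $ i) ^ \<alpha> i)) has_sum f x) UNIV)"
  proof (intro exI[of _ r] exI[of _ c] conjI r ballI impI)
    fix x assume x: "x \<in> polydisc a r"
    from c x have s: "((\<lambda>\<alpha>. c \<alpha> * (\<Prod>i\<in>UNIV. (x $ i - a $ i) ^ \<alpha> i)) has_sum g x) UNIV"
      by (simp add: power_series_sums_def)
    then show "(\<lambda>\<alpha>. c \<alpha> * (\<Prod>i\<in>UNIV. (x $ i - a $ i) ^ \<alpha> i)) summable_on UNIV"
      by (rule has_sum_imp_summable)
    show "((\<lambda>\<alpha>. c \<alpha> * (\<Prod>i\<in>UNIV. (x $ i - a $ i) ^ \<alpha> i)) has_sum f x) UNIV" if "x \<in> S"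
      using s eq x that by simp
  qed
qed

text \<open>
  The terms are dominated by their values at the real point \<open>a + (s,\<dots>,s)\<close> with \<open>s = r/2\<close>, and the
  series converges there.
\<close>

lemma continuous_on_power_series_analytic:
  fixes f :: "complex ^ 'p :: finite \<Rightarrow> complex"
  assumes "f power_series_analytic_on S"
  shows "continuous_on S f"
  unfolding continuous_on_eq_continuous_within
proof
  fix a assume "a \<in> S"
  then obtain r c where r: "r > 0"
    and sm: "\<And>x. x \<in> polydisc a r \<Longrightarrow>
        (\<lambda>\<alpha>. c \<alpha> * (\<Prod>i\<in>UNIV. (x $ i - a $ i) ^ \<alpha> i)) summable_on UNIV"
    and f: "\<And>x. x \<in> polydisc a r \<Longrightarrow> x \<in> S \<Longrightarrow>
        ((\<lambda>\<alpha>. c \<alpha> * (\<Prod>i\<in>UNIV. (x $ i - a $ i) ^ \<alpha> i)) has_sum f x) UNIV"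
    using assms unfolding power_series_analytic_on_iff by blast
  define T where "T \<alpha> x = c \<alpha> * (\<Prod>i\<in>UNIV. (x $ i - a $ i) ^ \<alpha> i)" for \<alpha> and x :: "complex ^ 'p"
  define s where "s = r / 2"
  have "(\<lambda>\<alpha>. T \<alpha> (\<chi> i. a $ i + of_real s)) summable_on UNIV"
    unfolding T_def using r by (intro sm) (auto simp: s_def polydisc_def)
  then have M: "(\<lambda>\<alpha>. norm (c \<alpha>) * (\<Prod>i\<in>(UNIV :: 'p set). s ^ \<alpha> i)) summable_on UNIV"
    using r by (simp add: summable_on_iff_abs_summable_on_complex T_def norm_mult prod_norm[symmetric] norm_power s_def)
  have "uniform_limit (ball a s) (\<lambda>X x. \<Sum>\<alpha>\<in>X. T \<alpha> x) (\<lambda>x. \<Sum>\<^sub>\<infinity>\<alpha>. T \<alpha> x) (finite_subsets_at_top UNIV)"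
  proof (rule Weierstrass_m_test_general[OF _ M])
    fix \<alpha> :: "'p \<Rightarrow> nat" and x assume "x \<in> ball a s"
    then have "norm (x $ i - a $ i) \<le> s" for i
      using Finite_Cartesian_Product.norm_nth_le[of "x - a" i] by (simp add: dist_norm norm_minus_commute)
    then show "norm (T \<alpha> x) \<le> norm (c \<alpha>) * (\<Prod>i\<in>(UNIV :: 'p set). s ^ \<alpha> i)"
      unfolding T_def norm_mult prod_norm[symmetric] norm_power
      by (intro mult_left_mono prod_mono conjI power_mono) auto
  qed
  then have "continuous_on (ball a s) (\<lambda>x. \<Sum>\<^sub>\<infinity>\<alpha>. T \<alpha> x)"
    by (rule uniform_limit_theorem[rotated])
      (auto simp: T_def intro!: always_eventually continuous_intros)
  then have "continuous (at a) (\<lambda>x. \<Sum>\<^sub>\<infinity>\<alpha>. T \<alpha> x)"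
    using r by (simp add: continuous_on_eq_continuous_at s_def)
  then have "continuous (at a within S) (\<lambda>x. \<Sum>\<^sub>\<infinity>\<alpha>. T \<alpha> x)"
    by (rule continuous_at_imp_continuous_at_within)
  then show "continuous (at a within S) f"
  proof (rule continuous_transform_within)
    show "0 < s" "a \<in> S"
      using r \<open>a \<in> S\<close> by (auto simp: s_def)
    show "(\<Sum>\<^sub>\<infinity>\<alpha>. T \<alpha> x) = f x" if "x \<in> S" "dist x a < s" for x
    proof (rule infsumI)
      have "norm (x $ i - a $ i) < r" for i
        using Finite_Cartesian_Product.norm_nth_le[of "x - a" i] that(2) r by (simp add: dist_norm s_def)
      then have "x \<in> polydisc a r"
        by (simp add: polydisc_def)
      with f that show "((\<lambda>\<alpha>. T \<alpha> x) has_sum f x) UNIV"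
        unfolding T_def by blast
    qed
  qed
qed

lemma has_power_series_at_cong:
  assumes "\<And>x. x \<in> polydisc a r \<Longrightarrow> f x = g x"
  shows "has_power_series_at f a r \<longleftrightarrow> has_power_series_at g a r"
  unfolding has_power_series_at_def power_series_sums_def using assms by simp

section \<open>Holomorphic functions of W\<close>

lemma W_diff: "W x - W a = (\<Sum>i\<in>UNIV. x $ i - a $ i)"
  by (simp add: W_def sum_subtractf)

lemma sum_norm_polydisc:
  fixes a :: "complex ^ 'p :: finite"
  assumes "x \<in> polydisc a r"
  shows "(\<Sum>i\<in>UNIV. norm (x $ i - a $ i)) < of_nat CARD('p) * r"
proof -
  have "(\<Sum>i\<in>UNIV. norm (x $ i - a $ i)) < (\<Sum>i\<in>(UNIV :: 'p set). r)"
    using assms by (intro sum_strict_mono) (auto simp: polydisc_def)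
  then show ?thesis by simp
qed

text \<open>
  In Cauchy's formula for \<open>f(W(x))\<close> the denominator is
  \<open>y - W(x) = (y - W(a)) (1 - \<Sum> (x\<^sub>i - a\<^sub>i) / (y - W(a)))\<close>.
\<close>

lemma has_power_series_at_compose_W:
  fixes a :: "complex ^ 'p :: finite"
  assumes f: "f holomorphic_on ball (W a) R" and "R > 0"
  shows "\<exists>r>0. has_power_series_at (\<lambda>x. f (W x)) a r"
proof -
  define \<rho> where "\<rho> = R / 2"
  have \<rho>: "0 < \<rho>" "\<rho> < R"
    using \<open>R > 0\<close> by (auto simp: \<rho>_def)
  have cont: "continuous_on (cball (W a) \<rho>) f"
    by (rule holomorphic_on_imp_continuous_on, rule holomorphic_on_subset[OF f]) (use \<rho> in auto)
  define A where "A y = f y / (y - W a)" for y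
  define B :: "'p \<Rightarrow> complex \<Rightarrow> complex" where "B i y = 1 / (y - W a)" for i y
  define I where "I x = contour_integral (circlepath (W a) \<rho>)
      (\<lambda>y. A y / (1 - (\<Sum>i\<in>UNIV. (x $ i - a $ i) * B i y)))" for x
  have "\<exists>r>0. has_power_series_at I a r"
    unfolding I_def
  proof (rule has_power_series_at_circle_integral[OF \<rho>(1)])
    show "continuous_on (sphere (W a) \<rho>) A"
      unfolding A_def using \<rho> by (intro continuous_intros continuous_on_subset[OF cont]) auto
    show "continuous_on (sphere (W a) \<rho>) (B i)" for i
      unfolding B_def using \<rho> by (intro continuous_intros) auto
  qed
  then obtain r where r: "r > 0" "has_power_series_at I a r"
    by blast
  define s where "s = min r (\<rho> / of_nat CARD('p))"
  have "s > 0"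
    using r \<rho> by (simp add: s_def)
  have eq: "1 / (2 * of_real pi * \<i>) * I x = f (W x)" if x: "x \<in> polydisc a s" for x
  proof -
    have "norm (W x - W a) \<le> (\<Sum>i\<in>UNIV. norm (x $ i - a $ i))"
      unfolding W_diff by (rule norm_sum)
    also have "\<dots> < of_nat CARD('p) * s"
      by (rule sum_norm_polydisc[OF x])
    also have "\<dots> \<le> \<rho>"
      by (simp add: s_def min_def field_simps)
    finally have near: "norm (W x - W a) < \<rho>" .
    have "((\<lambda>y. f y / (y - W x)) has_contour_integral 2 * of_real pi * \<i> * f (W x))
        (circlepath (W a) \<rho>)"
      using \<rho> by (intro Cauchy_integral_circlepath cont near holomorphic_on_subset[OF f]) auto
    then have "((\<lambda>y. A y / (1 - (\<Sum>i\<in>UNIV. (x $ i - a $ i) * B i y)))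
        has_contour_integral 2 * of_real pi * \<i> * f (W x)) (circlepath (W a) \<rho>)"
    proof (rule has_contour_integral_eq)
      fix y assume "y \<in> path_image (circlepath (W a) \<rho>)"
      then have "y \<noteq> W a" "y \<noteq> W x"
        using \<rho> near by (auto simp: dist_norm norm_minus_commute)
      moreover have "(\<Sum>i\<in>UNIV. (x $ i - a $ i) * B i y) = (W x - W a) / (y - W a)"
        by (simp add: B_def W_diff sum_divide_distrib)
      then have "1 - (\<Sum>i\<in>UNIV. (x $ i - a $ i) * B i y) = (y - W x) / (y - W a)"
        using \<open>y \<noteq> W a\<close> by (simp only:) (simp add: field_simps)
      ultimately show "f y / (y - W x) = A y / (1 - (\<Sum>i\<in>UNIV. (x $ i - a $ i) * B i y))"
        by (simp add: A_def)
    qed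
    then show ?thesis
      by (simp add: I_def contour_integral_unique)
  qed
  have "has_power_series_at (\<lambda>x. 1 / (2 * of_real pi * \<i>) * I x) a s"
    using has_power_series_at_mono[OF r(2), of s]
    by (intro has_power_series_at_cmult) (simp add: s_def)
  then have "has_power_series_at (\<lambda>x. f (W x)) a s"
    by (rule has_power_series_at_cong[THEN iffD1, rotated]) (rule eq)
  with \<open>s > 0\<close> show ?thesis
    by auto
qed

lemma Xi_iff_W_nonpos: "\<xi> \<in> Xi \<longleftrightarrow> W \<xi> \<in> \<real>\<^sub>\<le>\<^sub>0"
proof
  assume "\<xi> \<in> Xi"
  then obtain r where r: "(\<Sum>i\<in>UNIV. \<xi> $ i) = complex_of_real r" "r \<le> - 1"
    by (auto simp: Xi_def)
  then have "W \<xi> = complex_of_real (1 + r)" "1 + r \<le> 0"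
    by (auto simp: W_def)
  then show "W \<xi> \<in> \<real>\<^sub>\<le>\<^sub>0"
    by (simp only: nonpos_Reals_of_real_iff)
qed (use W_notin_nonpos in blast)

lemma continuous_on_W: "continuous_on S W"
  unfolding W_def by (intro continuous_intros)

lemma open_Compl_Xi: "open (- Xi :: (complex ^ 'p :: finite) set)"
proof -
  have "- Xi = W -` (- \<real>\<^sub>\<le>\<^sub>0) \<inter> (UNIV :: (complex ^ 'p) set)"
    by (auto simp: Xi_iff_W_nonpos)
  then show ?thesis
    using continuous_open_preimage[OF continuous_on_W open_UNIV, of "- \<real>\<^sub>\<le>\<^sub>0"]
    by (auto simp: open_Compl closed_nonpos_Reals_complex Int_commute)
qed

lemma W_root_eq_powr:
  assumes "n > 0" "\<xi> \<notin> Xi"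
  shows "W_root n \<xi> = W \<xi> powr (1 / of_nat n)"
  using is_root_branch_unique[OF assms(1) is_root_branch_W_root is_root_branch_powr assms(2)] assms(1)
  by blast

lemma W_pow_eq_powr:
  assumes "n > 0" "\<xi> \<notin> Xi"
  shows "W_pow n m \<xi> = W \<xi> powr (of_int m / of_nat n)"
proof -
  have "W \<xi> \<noteq> 0"
    using assms Xi_iff_W_nonpos by force
  then show ?thesis
    using assms by (simp add: W_pow_def W_root_eq_powr powr_def exp_power_int)
qed

section \<open>The Jacobian determinant\<close>

text \<open>
  If row \<open>k\<close> is \<open>w\<close> itself, the multiples of \<open>w\<close> in the other rows do not change the
  determinant, since they can be cleared with row \<open>k\<close>.
\<close>

lemma det_row_pivot_plus_rank_one:
  fixes u :: "'n :: finite \<Rightarrow> 'a :: field" and w :: "'a ^ 'n"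
  assumes "finite S" "k \<notin> S"
  shows "det (\<chi> i. if i = k then w else if i \<in> S then axis i 1 + u i *s w else axis i 1) = w $ k"
  using assms
proof (induction S)
  case empty
  have "row i (mat 1) = (axis i 1 :: 'a ^ 'n)" for i
    by (vector row_def mat_def axis_def)
  with cramer_lemma_transpose[of k w "mat 1"] show ?case
    by (simp add: basis_expansion cong: if_cong)
next
  case (insert j S)
  then have "j \<noteq> k" by auto
  define c where "c i = (if i = k then w else if i \<in> S then axis i 1 + u i *s w else axis i 1)" for i
  have "det (\<chi> i. if i = k then w else if i \<in> insert j S then axis i 1 + u i *s w else axis i 1)
      = det (\<chi> i. if i = j then axis i 1 + u i *s w else c i)"
    using \<open>j \<noteq> k\<close> by (intro arg_cong[where f = det]) (auto simp: vec_eq_iff c_def)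
  also have "\<dots> = det (\<chi> i. if i = j then axis i 1 else c i) + det (\<chi> i. if i = j then u i *s w else c i)"
    by (rule det_row_add)
  also have "(\<chi> i. if i = j then u i *s w else c i) = (\<chi> i. if i = j then u j *s w else c i)"
    by (auto simp: vec_eq_iff)
  also have "det (\<chi> i. if i = j then u j *s w else c i) = u j * det (\<chi> i. if i = j then w else c i)"
    by (rule det_row_mul)
  also have "det (\<chi> i. if i = j then w else c i) = 0"
    by (rule det_identical_rows[OF \<open>j \<noteq> k\<close>]) (use \<open>j \<noteq> k\<close> in \<open>auto simp: row_def vec_eq_iff c_def\<close>)
  also have "(\<chi> i. if i = j then axis i 1 else c i) = (\<chi> i. c i)"
    using insert \<open>j \<noteq> k\<close> by (auto simp: vec_eq_iff c_def)
  also have "det (\<chi> i. c i) = w $ k"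
    unfolding c_def using insert by auto
  finally show ?case by simp
qed

text \<open>
  Perturb one row after the other. By linearity in row \<open>k\<close> the new term is \<open>u\<^sub>k\<close> times a
  determinant with row \<open>k\<close> equal to \<open>w\<close>.
\<close>

lemma det_identity_plus_rank_one:
  fixes u :: "'n :: finite \<Rightarrow> 'a :: field" and w :: "'a ^ 'n"
  shows "det (\<chi> i. axis i 1 + u i *s w) = 1 + (\<Sum>i\<in>UNIV. u i * w $ i)"
proof -
  have "det (\<chi> i. if i \<in> S then axis i 1 + u i *s w else axis i 1) = 1 + (\<Sum>i\<in>S. u i * w $ i)"
    if "finite S" for S
    using that
  proof (induction S)
    case empty
    have "(\<chi> i. axis i 1) = (mat 1 :: 'a ^ 'n ^ 'n)"
      by (vector mat_def axis_def)
    then show ?case by simp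
  next
    case (insert k S)
    define c where "c i = (if i \<in> S then axis i 1 + u i *s w else axis i 1)" for i
    have "det (\<chi> i. if i \<in> insert k S then axis i 1 + u i *s w else axis i 1)
        = det (\<chi> i. if i = k then axis i 1 + u i *s w else c i)"
      by (intro arg_cong[where f = det]) (auto simp: vec_eq_iff c_def)
    also have "\<dots> = det (\<chi> i. if i = k then axis i 1 else c i) + det (\<chi> i. if i = k then u i *s w else c i)"
      by (rule det_row_add)
    also have "(\<chi> i. if i = k then u i *s w else c i) = (\<chi> i. if i = k then u k *s w else c i)"
      by (auto simp: vec_eq_iff)
    also have "det (\<chi> i. if i = k then u k *s w else c i) = u k * det (\<chi> i. if i = k then w else c i)"
      by (rule det_row_mul)
    also have "det (\<chi> i. if i = k then w else c i) = w $ k"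
      unfolding c_def using det_row_pivot_plus_rank_one[OF insert(1,2)] .
    also have "(\<chi> i. if i = k then axis i 1 else c i) = (\<chi> i. c i)"
      using insert by (auto simp: vec_eq_iff c_def)
    also have "det (\<chi> i. c i) = 1 + (\<Sum>i\<in>S. u i * w $ i)"
      unfolding c_def using insert by auto
    finally show ?case
      using insert by simp
  qed
  from this[of UNIV] show ?thesis by simp
qed

lemma has_derivative_coord_mult_W_powr:
  fixes \<xi> :: "complex ^ 'p :: finite"
  assumes "\<xi> \<notin> Xi"
  shows "((\<lambda>\<xi>. \<xi> $ i * W \<xi> powr s) has_derivative
     (\<lambda>v. v $ i * W \<xi> powr s + \<xi> $ i * (s * W \<xi> powr (s - 1)) * (\<Sum>j\<in>UNIV. v $ j))) (at \<xi>)"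
proof -
  have "W \<xi> \<notin> \<real>\<^sub>\<le>\<^sub>0"
    using assms Xi_iff_W_nonpos by blast
  then have d: "((\<lambda>w. w powr s) has_field_derivative s * W \<xi> powr (s - 1)) (at (W \<xi>))"
    by (rule has_field_derivative_powr)
  have "(W has_derivative (\<lambda>v. \<Sum>i\<in>UNIV. v $ i)) (at \<xi>)"
    unfolding W_def
    by (auto intro!: derivative_eq_intros bounded_linear.has_derivative[OF bounded_linear_vec_nth])
  from has_derivative_compose[OF this d[unfolded has_field_derivative_def]]
  have "((\<lambda>\<xi>. W \<xi> powr s) has_derivative
      (\<lambda>v. s * W \<xi> powr (s - 1) * (\<Sum>i\<in>UNIV. v $ i))) (at \<xi>)" .
  from has_derivative_mult[OF bounded_linear.has_derivative[OF bounded_linear_vec_nth has_derivative_ident, of i] this]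
  show ?thesis
    by (simp add: algebra_simps)
qed

lemma has_derivative_Psi:
  fixes \<xi> :: "complex ^ 'p :: finite" and ns :: "'p \<Rightarrow> nat"
  assumes "n > 0" "\<xi> \<notin> Xi"
  defines "s \<equiv> \<lambda>i. of_int (int (ns i) - int n) / of_nat n"
  shows "((\<lambda>\<xi>. Psi n ns \<xi> $ i) has_derivative
     (\<lambda>v. v $ i * W \<xi> powr s i + \<xi> $ i * (s i * W \<xi> powr (s i - 1)) * (\<Sum>j\<in>UNIV. v $ j))) (at \<xi>)"
  by (rule has_derivative_transform_within_open[OF
        has_derivative_coord_mult_W_powr[OF assms(2)] open_Compl_Xi])
    (use assms in \<open>auto simp: Psi_def W_pow_eq_powr\<close>)

lemma holomorphic_Psi:
  fixes ns :: "'p :: finite \<Rightarrow> nat"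
  assumes "n > 0"
  shows "Psi n ns holomorphic_map_on (- Xi)"
  unfolding holomorphic_map_on_def holomorphic_fun_on_def
proof (intro allI ballI)
  fix i and \<xi> :: "complex ^ 'p" assume "\<xi> \<in> - Xi"
  then have "\<xi> \<notin> Xi" by simp
  define s :: complex where "s = of_int (int (ns i) - int n) / of_nat n"
  have "v $ i * W \<xi> powr s + \<xi> $ i * (s * W \<xi> powr (s - 1)) * (\<Sum>j\<in>UNIV. v $ j)
      = (\<Sum>j\<in>UNIV. ((if j = i then W \<xi> powr s else 0) + \<xi> $ i * (s * W \<xi> powr (s - 1))) * v $ j)"
    for v
    by (simp add: ring_distribs sum.distrib sum_distrib_left if_distrib[of "\<lambda>x. x * _"] cong: if_cong)
  with has_derivative_Psi[OF assms \<open>\<xi> \<notin> Xi\<close>, of ns i]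
  show "\<exists>a. ((\<lambda>\<xi>. Psi n ns \<xi> $ i) has_derivative (\<lambda>v. \<Sum>j\<in>UNIV. a j * v $ j)) (at \<xi> within - Xi)"
    unfolding s_def by (auto intro: has_derivative_at_withinI)
qed

text \<open>
  With \<open>s\<^sub>i = n\<^sub>i/n - 1\<close>, row \<open>i\<close> of the Jacobian matrix is \<open>W^(s\<^sub>i)\<close> times
  \<open>e\<^sub>i + (\<xi>\<^sub>i s\<^sub>i / W) (1,\<dots>,1)\<close>.
\<close>

lemma det_jacobian_Psi:
  fixes \<xi> :: "complex ^ 'p :: finite"
  assumes "n > 0" "\<xi> \<notin> Xi"
  shows "det (jacobian (Psi n ns) (at \<xi>)) =
     W_pow n ((\<Sum>k\<in>UNIV. int (ns k)) - int n * (int CARD('p) + 1)) \<xi> *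
     (1 + 1 / of_nat n * (\<Sum>k\<in>UNIV. of_nat (ns k) * \<xi> $ k))"
proof -
  define s :: "'p \<Rightarrow> complex" where "s i = of_int (int (ns i) - int n) / of_nat n" for i
  have W0: "W \<xi> \<noteq> 0"
    using assms Xi_iff_W_nonpos by force
  define D where "D v = (\<chi> i. v $ i * W \<xi> powr s i
      + \<xi> $ i * (s i * W \<xi> powr (s i - 1)) * (\<Sum>j\<in>UNIV. v $ j))" for v
  have "(Psi n ns has_derivative D) (at \<xi>)"
    unfolding has_derivative_componentwise_within[of "Psi n ns"]
  proof
    fix b :: "complex ^ 'p" assume "b \<in> Basis"
    then obtain i u where "b = axis i u"
      by (auto simp: Basis_vec_def)
    moreover have "((\<lambda>\<xi>. Psi n ns \<xi> $ i) has_derivative (\<lambda>v. D v $ i)) (at \<xi>)"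
      using has_derivative_Psi[OF assms, of ns i] by (simp add: D_def s_def)
    ultimately show "((\<lambda>\<xi>. Psi n ns \<xi> \<bullet> b) has_derivative (\<lambda>v. D v \<bullet> b)) (at \<xi>)"
      by (simp add: inner_axis has_derivative_inner_left)
  qed
  then have "jacobian (Psi n ns) (at \<xi>) = matrix D"
    by (simp add: jacobian_def frechet_derivative_at[symmetric])
  also have "\<dots> = (\<chi> i. W \<xi> powr s i *s (axis i 1 + (\<xi> $ i * s i / W \<xi>) *s 1))"
  proof -
    have "(\<Sum>k\<in>UNIV. axis j (1 :: complex) $ k) = 1" for j :: 'p
      by (simp add: axis_def)
    then show ?thesis
      using W0 by (auto simp: matrix_def D_def vec_eq_iff axis_def powr_diff algebra_simps)
  qed
  finally have J: "jacobian (Psi n ns) (at \<xi>) = (\<chi> i. W \<xi> powr s i *s (axis i 1 + (\<xi> $ i * s i / W \<xi>) *s 1))" .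
  have "det (jacobian (Psi n ns) (at \<xi>))
      = (\<Prod>i\<in>UNIV. W \<xi> powr s i) * (1 + (\<Sum>i\<in>UNIV. \<xi> $ i * s i / W \<xi>))"
    unfolding J det_rows_mul det_identity_plus_rank_one by simp
  also have "(\<Prod>i\<in>UNIV. W \<xi> powr s i) = W \<xi> powr (\<Sum>i\<in>UNIV. s i)"
    using W0 by (simp add: powr_sum)
  also have "1 + (\<Sum>i\<in>UNIV. \<xi> $ i * s i / W \<xi>) = (W \<xi> + (\<Sum>i\<in>UNIV. \<xi> $ i * s i)) / W \<xi>"
    using W0 by (simp add: sum_divide_distrib add_divide_distrib)
  also have "W \<xi> powr (\<Sum>i\<in>UNIV. s i) * ((W \<xi> + (\<Sum>i\<in>UNIV. \<xi> $ i * s i)) / W \<xi>)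
      = W \<xi> powr ((\<Sum>i\<in>UNIV. s i) - 1) * (W \<xi> + (\<Sum>i\<in>UNIV. \<xi> $ i * s i))"
    using W0 by (simp add: powr_diff)
  also have "(\<Sum>i\<in>UNIV. s i) - 1
      = of_int ((\<Sum>k\<in>UNIV. int (ns k)) - int n * (int CARD('p) + 1)) / of_nat n"
    using assms(1) by (simp add: s_def sum_divide_distrib[symmetric] sum_subtractf field_simps)
  also have "W \<xi> + (\<Sum>i\<in>UNIV. \<xi> $ i * s i) = 1 + (\<Sum>i\<in>UNIV. \<xi> $ i * (1 + s i))"
    by (simp add: W_def ring_distribs sum.distrib)
  also have "(\<Sum>i\<in>UNIV. \<xi> $ i * (1 + s i)) = 1 / of_nat n * (\<Sum>k\<in>UNIV. of_nat (ns k) * \<xi> $ k)"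
    using assms(1) unfolding sum_distrib_left by (intro sum.cong) (auto simp: s_def field_simps)
  finally show ?thesis
    using W_pow_eq_powr[OF assms] by simp
qed

section \<open>The positive root\<close>

text \<open>
  This is the polynomial \<open>F(x,z)\<close> of the introduction, and its \<open>Q(x,y,z)\<close> is \<open>eqn_quot\<close> below.
\<close>

definition eqn :: "nat \<Rightarrow> ('p :: finite \<Rightarrow> nat) \<Rightarrow> complex ^ 'p \<Rightarrow> complex \<Rightarrow> complex" where
  "eqn n ns x z = z ^ n + (\<Sum>i\<in>UNIV. x $ i * z ^ ns i) - 1"

definition power_quot :: "nat \<Rightarrow> 'a \<Rightarrow> 'a \<Rightarrow> 'a :: comm_semiring_1" where
  "power_quot m y z = (\<Sum>j<m. z ^ (m - Suc j) * y ^ j)"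

lemma power_diff_eq_power_quot: "y ^ m - z ^ m = (y - z) * power_quot m y z"
  for y z :: "'a :: comm_ring_1"
  unfolding power_quot_def by (rule power_diff_sumr2)

text \<open>
  The difference quotient of \<open>eqn n ns x\<close> between \<open>y\<close> and \<open>z\<close>, as a polynomial that also makes
  sense for \<open>y = z\<close>, where it is the derivative.
\<close>

definition eqn_quot :: "nat \<Rightarrow> ('p :: finite \<Rightarrow> nat) \<Rightarrow> complex ^ 'p \<Rightarrow> complex \<Rightarrow> complex \<Rightarrow> complex" where
  "eqn_quot n ns x y z = power_quot n y z + (\<Sum>i\<in>UNIV. x $ i * power_quot (ns i) y z)"

lemma eqn_diff: "eqn n ns x y - eqn n ns x z = (y - z) * eqn_quot n ns x y z"
proof -
  have "eqn n ns x y - eqn n ns x z = (y ^ n - z ^ n) + (\<Sum>i\<in>UNIV. x $ i * (y ^ ns i - z ^ ns i))"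
    by (simp add: eqn_def right_diff_distrib sum_subtractf)
  also have "\<dots> = (y - z) * eqn_quot n ns x y z"
    unfolding power_diff_eq_power_quot eqn_quot_def
    by (simp add: distrib_left sum_distrib_left mult.left_commute)
  finally show ?thesis .
qed

text \<open>
  All terms are nonnegative, and \<open>z^(n - 1)\<close> is one of them. The lower bound is uniform in \<open>x\<close> and
  \<open>y\<close>, which gives simplicity, uniqueness and continuity of the positive root.
\<close>

lemma eqn_quot_of_real:
  assumes "x \<in> orthant" "0 \<le> y" "0 \<le> z" "n > 0"
  obtains q where "eqn_quot n ns x (of_real y) (of_real z) = of_real q" "z ^ (n - 1) \<le> q"
proof
  have pq: "power_quot m (of_real y) (of_real z) = complex_of_real (power_quot m y z)" for m
    by (simp add: power_quot_def)
  have x: "x $ i = of_real (Re (x $ i))" "0 \<le> Re (x $ i)" for i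
    using assms(1) by (auto simp: orthant_def complex_nonneg_Reals_iff complex_eq_iff)
  have nn: "0 \<le> power_quot m y z" for m
    unfolding power_quot_def using assms by (intro sum_nonneg) auto
  define q where "q = power_quot n y z + (\<Sum>i\<in>UNIV. Re (x $ i) * power_quot (ns i) y z)"
  have "eqn_quot n ns x (of_real y) (of_real z)
      = of_real (power_quot n y z) + (\<Sum>i\<in>UNIV. of_real (Re (x $ i)) * of_real (power_quot (ns i) y z))"
    unfolding eqn_quot_def pq using x(1) by (metis (no_types, lifting) sum.cong)
  then show "eqn_quot n ns x (of_real y) (of_real z) = of_real q"
    by (simp add: q_def)
  have "z ^ (n - Suc 0) * y ^ 0 \<le> power_quot n y z"
    unfolding power_quot_def by (rule member_le_sum) (use assms in auto)
  moreover have "0 \<le> (\<Sum>i\<in>UNIV. Re (x $ i) * power_quot (ns i) y z)"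
    using x(2) nn by (intro sum_nonneg mult_nonneg_nonneg)
  ultimately show "z ^ (n - 1) \<le> q"
    by (simp add: q_def)
qed

lemma eqn_root_unique:
  assumes "x \<in> orthant" "n > 0" "0 < y" "0 < z"
    and "eqn n ns x (of_real y) = 0" "eqn n ns x (of_real z) = 0"
  shows "y = z"
proof -
  obtain q where q: "eqn_quot n ns x (of_real y) (of_real z) = of_real q" "z ^ (n - 1) \<le> q"
    using eqn_quot_of_real assms by (metis less_imp_le)
  have "q > 0"
    using q(2) zero_less_power[OF assms(4), of "n - 1"] by linarith
  moreover have "(complex_of_real y - of_real z) * of_real q = 0"
    using eqn_diff[of n ns x "of_real y" "of_real z"] assms q by simp
  ultimately show ?thesis
    by simp
qed

lemma eqn_root_exists:
  assumes "x \<in> orthant" "n > 0" "\<And>i. ns i > 0"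
  shows "\<exists>z. 0 < z \<and> z \<le> 1 \<and> eqn n ns x (of_real z) = 0"
proof -
  define f where "f t = t ^ n + (\<Sum>i\<in>UNIV. Re (x $ i) * t ^ ns i) - 1" for t :: real
  have x: "x $ i = of_real (Re (x $ i))" "0 \<le> Re (x $ i)" for i
    using assms(1) by (auto simp: orthant_def complex_nonneg_Reals_iff complex_eq_iff)
  have eqn: "eqn n ns x (of_real t) = of_real (f t)" for t
  proof -
    have "(\<Sum>i\<in>UNIV. x $ i * of_real t ^ ns i) = (\<Sum>i\<in>UNIV. of_real (Re (x $ i)) * of_real t ^ ns i)"
      using x(1) by (intro sum.cong) auto
    then show ?thesis
      by (simp add: eqn_def f_def)
  qed
  have "(\<Sum>i\<in>UNIV. Re (x $ i) * 0 ^ ns i) = 0"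
    by (intro sum.neutral ballI) (simp add: zero_power assms(3))
  then have "f 0 = -1"
    unfolding f_def using assms(2) by (simp only: zero_power)
  moreover have "f 1 \<ge> 0"
    using x(2) by (simp add: f_def sum_nonneg)
  moreover have "continuous_on {0..1} f"
    unfolding f_def by (intro continuous_intros)
  ultimately obtain z where z: "0 \<le> z" "z \<le> 1" "f z = 0"
    using IVT'[of f 0 0 1] by auto
  with \<open>f 0 = -1\<close> have "z \<noteq> 0"
    by auto
  with z eqn show ?thesis
    by (intro exI[of _ z]) auto
qed

definition pos_root :: "nat \<Rightarrow> ('p :: finite \<Rightarrow> nat) \<Rightarrow> complex ^ 'p \<Rightarrow> real" where
  "pos_root n ns x = (THE z. 0 < z \<and> eqn n ns x (of_real z) = 0)"

lemma pos_root_eqI: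
  assumes "x \<in> orthant" "n > 0" "0 < z" "eqn n ns x (of_real z) = 0"
  shows "pos_root n ns x = z"
  unfolding pos_root_def using assms eqn_root_unique by (intro the_equality) auto

lemma pos_root:
  assumes "x \<in> orthant" "n > 0" "\<And>i. ns i > 0"
  shows "0 < pos_root n ns x" "pos_root n ns x \<le> 1" "eqn n ns x (of_real (pos_root n ns x)) = 0"
  using eqn_root_exists[of x n ns] pos_root_eqI[of x n _ ns] assms by auto

section \<open>The bijection of the orthant\<close>

lemma W_orthant:
  assumes "\<xi> \<in> orthant"
  obtains w where "W \<xi> = of_real w" "1 \<le> w"
proof
  have "\<xi> $ i = of_real (Re (\<xi> $ i))" "0 \<le> Re (\<xi> $ i)" for i
    using assms by (auto simp: orthant_def complex_nonneg_Reals_iff complex_eq_iff)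
  then show "W \<xi> = of_real (1 + (\<Sum>i\<in>UNIV. Re (\<xi> $ i)))" "1 \<le> 1 + (\<Sum>i\<in>UNIV. Re (\<xi> $ i))"
    by (auto simp: W_def sum_nonneg)
qed

lemma orthant_disjoint_Xi: "\<xi> \<in> orthant \<Longrightarrow> \<xi> \<notin> Xi"
  using W_orthant[of \<xi>] unfolding Xi_iff_W_nonpos by (metis nonpos_Reals_of_real_iff not_one_le_zero order_trans)

lemma W_root_orthant:
  assumes "\<xi> \<in> orthant" "n > 0"
  obtains s where "W_root n \<xi> = of_real s" "1 \<le> s" "W \<xi> = of_real (s ^ n)"
proof -
  obtain w where w: "W \<xi> = of_real w" "1 \<le> w"
    using W_orthant[OF assms(1)] .
  define s where "s = w powr (1 / real n)"
  have "W_root n \<xi> = of_real w powr of_real (1 / real n)"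
    using W_root_eq_powr[OF assms(2) orthant_disjoint_Xi[OF assms(1)]] w by simp
  also have "\<dots> = of_real s"
    unfolding s_def using w by (intro powr_of_real) auto
  finally have "W_root n \<xi> = of_real s" .
  moreover have "s ^ n = w"
    using w assms(2) by (simp add: s_def powr_power)
  moreover have "1 \<le> s"
    using w by (simp add: s_def ge_one_powr_ge_zero)
  ultimately show ?thesis
    by (intro that) (use w in auto)
qed

lemma W_pow_diff_orthant:
  assumes "\<xi> \<in> orthant" "n > 0" "W_root n \<xi> = of_real s" "m \<le> n"
  shows "W_pow n (int m - int n) \<xi> = of_real (1 / s ^ (n - m))"
proof -
  have eq: "int m - int n = - int (n - m)"
    using assms(4) by simp
  show ?thesis
    unfolding W_pow_def assms(3) eq by (simp add: power_int_minus field_simps)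
qed

definition Psi_inv :: "nat \<Rightarrow> ('p :: finite \<Rightarrow> nat) \<Rightarrow> complex ^ 'p \<Rightarrow> complex ^ 'p" where
  "Psi_inv n ns x = (\<chi> i. x $ i * (1 / of_real (pos_root n ns x) ^ (n - ns i)))"

lemma orthant_mult_of_real:
  "x \<in> orthant \<Longrightarrow> (\<And>i. 0 \<le> t i) \<Longrightarrow> (\<chi> i. x $ i * of_real (t i)) \<in> orthant"
  unfolding orthant_def by (auto intro!: nonneg_Reals_mult_I)

text \<open>
  The reciprocal of \<open>s = W(\<xi>)\<^sup>1\<^sup>/\<^sup>n\<close> solves the equation with parameter \<open>\<Psi>(\<xi>)\<close>, because
  \<open>\<xi>\<^sub>i s^(n\<^sub>i - n) s^(-n\<^sub>i) = \<xi>\<^sub>i / s^n\<close>. So \<open>s\<close>, and with it \<open>\<xi>\<close>, can be recovered from \<open>\<Psi>(\<xi>)\<close>.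
\<close>

lemma Psi_orthant:
  assumes \<xi>: "\<xi> \<in> orthant" and n: "n > 0" "\<And>i. ns i < n"
  shows "Psi n ns \<xi> \<in> orthant" "of_real (pos_root n ns (Psi n ns \<xi>)) = 1 / W_root n \<xi>"
    "Psi_inv n ns (Psi n ns \<xi>) = \<xi>"
proof -
  obtain s where s: "W_root n \<xi> = of_real s" "1 \<le> s" "W \<xi> = of_real (s ^ n)"
    using W_root_orthant[OF \<xi> n(1)] .
  have Psi: "Psi n ns \<xi> = (\<chi> i. \<xi> $ i * of_real (1 / s ^ (n - ns i)))"
    using W_pow_diff_orthant[OF \<xi> n(1) s(1)] n(2) by (simp add: Psi_def less_imp_le)
  show orth: "Psi n ns \<xi> \<in> orthant"
    unfolding Psi using s by (intro orthant_mult_of_real \<xi>) auto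
  have summand: "\<xi> $ i * of_real (1 / s ^ (n - ns i)) * of_real (1 / s) ^ ns i = \<xi> $ i / of_real s ^ n" for i
  proof -
    have "s ^ n = s ^ (n - ns i) * s ^ ns i"
      using n(2)[of i] by (simp flip: power_add)
    then have "complex_of_real s ^ n = of_real s ^ (n - ns i) * of_real s ^ ns i"
      by (metis of_real_mult of_real_power)
    then show ?thesis
      by (simp add: power_divide)
  qed
  have "eqn n ns (Psi n ns \<xi>) (of_real (1 / s)) = of_real (1 / s) ^ n + (\<Sum>i\<in>UNIV. \<xi> $ i / of_real s ^ n) - 1"
    unfolding eqn_def Psi vec_lambda_beta summand ..
  also have "\<dots> = W \<xi> / of_real s ^ n - 1"
    by (simp add: W_def add_divide_distrib sum_divide_distrib power_divide)
  also have "\<dots> = 0"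
    using s by simp
  finally have root: "pos_root n ns (Psi n ns \<xi>) = 1 / s"
    using s by (intro pos_root_eqI orth n) auto
  then show "of_real (pos_root n ns (Psi n ns \<xi>)) = 1 / W_root n \<xi>"
    by (simp add: s)
  show "Psi_inv n ns (Psi n ns \<xi>) = \<xi>"
    unfolding Psi_inv_def root using s by (simp add: Psi vec_eq_iff power_divide)
qed

text \<open>
  Multiplying \<open>W\<close> at the candidate preimage by \<open>z^n\<close> gives \<open>z^n + \<Sum> x\<^sub>i z^(n\<^sub>i) = 1\<close>, so that \<open>W\<^sup>1\<^sup>/\<^sup>n\<close> is
  \<open>1/z\<close> there.
\<close>

lemma Psi_inv_orthant:
  assumes x: "x \<in> orthant" and n: "n > 0" "\<And>i. 0 < ns i" "\<And>i. ns i < n"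
  shows "Psi_inv n ns x \<in> orthant" "W_root n (Psi_inv n ns x) = 1 / of_real (pos_root n ns x)"
    "Psi n ns (Psi_inv n ns x) = x"
proof -
  define z where "z = pos_root n ns x"
  have z: "0 < z" "z \<le> 1" "eqn n ns x (of_real z) = 0"
    unfolding z_def using pos_root[OF x n(1,2)] by auto
  have inv: "Psi_inv n ns x = (\<chi> i. x $ i * of_real (1 / z ^ (n - ns i)))"
    by (simp add: Psi_inv_def z_def)
  show orth: "Psi_inv n ns x \<in> orthant"
    unfolding inv using z by (intro orthant_mult_of_real x) auto
  have "x $ i * of_real (1 / z ^ (n - ns i)) * of_real z ^ n = x $ i * of_real z ^ ns i" for i
  proof -
    have "z ^ n = z ^ (n - ns i) * z ^ ns i"
      using n(3)[of i] by (simp flip: power_add)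
    then have "complex_of_real z ^ n = of_real z ^ (n - ns i) * of_real z ^ ns i"
      by (metis of_real_mult of_real_power)
    then show ?thesis
      using z by simp
  qed
  then have "W (Psi_inv n ns x) * of_real z ^ n = of_real z ^ n + (\<Sum>i\<in>UNIV. x $ i * of_real z ^ ns i)"
    by (simp add: W_def inv ring_distribs sum_distrib_right)
  also have "\<dots> = 1"
    using z(3) by (simp add: eqn_def)
  finally have W: "W (Psi_inv n ns x) * of_real z ^ n = 1" .
  obtain s where s: "W_root n (Psi_inv n ns x) = of_real s" "1 \<le> s" "W (Psi_inv n ns x) = of_real (s ^ n)"
    using W_root_orthant[OF orth n(1)] .
  have "complex_of_real ((s * z) ^ n) = of_real 1"
    using W s by (simp add: power_mult_distrib)
  then have "(s * z) ^ n = 1"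
    unfolding of_real_eq_iff .
  then have "s * z = 1"
    using power_eq_imp_eq_base[of "s * z" n 1] n(1) s z by auto
  then have sz: "s = 1 / z"
    using z by (simp add: field_simps)
  then show "W_root n (Psi_inv n ns x) = 1 / of_real (pos_root n ns x)"
    using s by (simp add: z_def)
  have "Psi n ns (Psi_inv n ns x) $ i = x $ i" for i
    using W_pow_diff_orthant[OF orth n(1) s(1), of "ns i"] n(3)[of i] z
    by (simp add: Psi_def inv sz power_divide)
  then show "Psi n ns (Psi_inv n ns x) = x"
    by (simp add: vec_eq_iff)
qed

lemma bij_betw_Psi:
  assumes "n > 0" "\<And>i. 0 < ns i" "\<And>i. ns i < n"
  shows "bij_betw (Psi n ns) orthant orthant"
  using Psi_orthant[of _ n ns] Psi_inv_orthant[of _ n ns] assms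
  by (intro bij_betw_byWitness[where f' = "Psi_inv n ns"]) auto

lemma inv_into_Psi:
  assumes "n > 0" "\<And>i. 0 < ns i" "\<And>i. ns i < n" "x \<in> orthant"
  shows "inv_into orthant (Psi n ns) x = Psi_inv n ns x"
  using bij_betw_Psi[of n ns] Psi_inv_orthant[of x n ns] assms
  by (intro inv_into_f_eq) (auto simp: bij_betw_def)

text \<open>
  On the orthant \<open>Re W \<ge> 1\<close>, so the unit disc around \<open>W(a)\<close> avoids the branch cut.
\<close>

lemma Psi_power_series_analytic:
  fixes ns :: "'p :: finite \<Rightarrow> nat"
  assumes "n > 0"
  shows "(\<lambda>\<xi>. Psi n ns \<xi> $ i) power_series_analytic_on orthant"
proof (rule power_series_analytic_onI)
  fix a :: "complex ^ 'p" assume a: "a \<in> orthant"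
  define s :: complex where "s = of_int (int (ns i) - int n) / of_nat n"
  obtain w where w: "W a = of_real w" "1 \<le> w"
    using W_orthant[OF a] .
  have "(\<lambda>y. y powr s) holomorphic_on ball (W a) 1"
  proof (intro holomorphic_intros)
    fix y assume "y \<in> ball (W a) 1"
    then have "\<bar>Re (W a - y)\<bar> < 1"
      using abs_Re_le_cmod[of "W a - y"] by (simp add: dist_norm)
    then show "y \<notin> \<real>\<^sub>\<le>\<^sub>0"
      using w by (auto simp: complex_nonpos_Reals_iff)
  qed
  then obtain r where r: "r > 0" "has_power_series_at (\<lambda>x. W x powr s) a r"
    using has_power_series_at_compose_W[of "\<lambda>y. y powr s" a 1] by auto
  show "\<exists>g r. r > 0 \<and> has_power_series_at g a r \<and> (\<forall>x\<in>orthant \<inter> polydisc a r. Psi n ns x $ i = g x)"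
  proof (intro exI conjI ballI)
    show "has_power_series_at (\<lambda>x. x $ i * W x powr s) a r"
      by (rule has_power_series_at_mult_coord[OF r(2)])
    fix x assume "x \<in> orthant \<inter> polydisc a r"
    then show "Psi n ns x $ i = x $ i * W x powr s"
      using W_pow_eq_powr[OF assms orthant_disjoint_Xi, of x] by (simp add: Psi_def s_def)
  qed (rule r(1))
qed

section \<open>The positive root as a residue\<close>

lemma continuous_eqn_quot:
  "isCont (\<lambda>(x, y, z). eqn_quot n ns x y z) (p :: (complex ^ 'p :: finite) \<times> complex \<times> complex)"
proof -
  have "continuous_on UNIV (\<lambda>(x :: complex ^ 'p, y, z). eqn_quot n ns x y z)"
    unfolding eqn_quot_def power_quot_def case_prod_unfold by (intro continuous_intros)
  then show ?thesis
    by (cases p) (simp add: continuous_on_eq_continuous_at)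
qed

lemma eqn_quot_nonzero_near:
  fixes a :: "complex ^ 'p :: finite"
  assumes "eqn_quot n ns a z0 z0 \<noteq> 0"
  obtains e where "e > 0" "\<And>x y z. x \<in> polydisc a e \<Longrightarrow> norm (y - z0) < e \<Longrightarrow> norm (z - z0) < e
    \<Longrightarrow> eqn_quot n ns x y z \<noteq> 0"
proof -
  obtain e where e: "e > 0"
    "\<And>p. dist (a, z0, z0) p < e \<Longrightarrow> (\<lambda>(x, y, z). eqn_quot n ns x y z) p \<noteq> 0"
    using continuous_at_avoid[OF continuous_eqn_quot[of "(a, z0, z0)" n ns], of 0] assms by auto
  \<comment> \<open>The distance in the product is at most the sum of \<open>CARD('p) + 2\<close> coordinate distances.\<close>
  define d where "d = e / (of_nat CARD('p) + 2)"
  have pos: "0 < real CARD('p) + 2"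
    by (simp add: add_pos_nonneg)
  have "d > 0"
    using e pos by (simp add: d_def)
  moreover have "eqn_quot n ns x y z \<noteq> 0"
    if "x \<in> polydisc a d" "norm (y - z0) < d" "norm (z - z0) < d" for x y z
  proof -
    have "dist a x \<le> (\<Sum>i\<in>UNIV. norm (x $ i - a $ i))"
      unfolding dist_norm norm_vec_def by (rule order_trans[OF L2_set_le_sum]) (auto simp: norm_minus_commute)
    also have "\<dots> < of_nat CARD('p) * d"
      by (rule sum_norm_polydisc[OF that(1)])
    finally have "dist a x < of_nat CARD('p) * d" .
    moreover have "dist (z0, z0) (y, z) \<le> dist z0 y + dist z0 z"
      unfolding dist_Pair_Pair by (rule sqrt_sum_squares_le_sum) auto
    moreover have "dist (a, z0, z0) (x, y, z) \<le> dist a x + dist (z0, z0) (y, z)"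
      unfolding dist_Pair_Pair[of a "(z0, z0)"] by (rule sqrt_sum_squares_le_sum) auto
    ultimately have "dist (a, z0, z0) (x, y, z) < of_nat CARD('p) * d + (d + d)"
      using that(2,3) by (simp add: dist_norm norm_minus_commute)
    also have "\<dots> = (real CARD('p) + 2) * d"
      by (simp add: algebra_simps)
    also have "\<dots> = e"
      using pos by (simp add: d_def)
    finally show ?thesis
      using e(2)[of "(x, y, z)"] by simp
  qed
  ultimately show ?thesis
    using that by blast
qed

lemma eqn_quot_pos_root_nonzero:
  assumes "x \<in> orthant" "n > 0" "\<And>i. ns i > 0"
  shows "eqn_quot n ns x (of_real (pos_root n ns x)) (of_real (pos_root n ns x)) \<noteq> 0"
proof -
  define z where "z = pos_root n ns x"
  have "z > 0"
    unfolding z_def by (rule pos_root[OF assms])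
  obtain q where q: "eqn_quot n ns x (of_real z) (of_real z) = of_real q" "z ^ (n - 1) \<le> q"
    using eqn_quot_of_real[of x z z n ns] assms \<open>z > 0\<close> by auto
  then show ?thesis
    using zero_less_power[OF \<open>z > 0\<close>, of "n - 1"] by (simp add: z_def)
qed

text \<open>
  For the roots \<open>y\<close> at \<open>x\<close> and \<open>z\<close> at \<open>a\<close>, the factorisation gives
  \<open>(z - y) Q(x,y,z) = F(x,z) - F(a,z) = \<Sum> (x\<^sub>i - a\<^sub>i) z^(n\<^sub>i)\<close>, and \<open>Q \<ge> z^(n - 1)\<close>.
\<close>

lemma pos_root_continuous:
  fixes a :: "complex ^ 'p :: finite"
  assumes a: "a \<in> orthant" and n: "n > 0" "\<And>i. ns i > 0" and "e > 0"
  obtains d where "d > 0"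
    "\<And>x. x \<in> orthant \<Longrightarrow> x \<in> polydisc a d \<Longrightarrow> \<bar>pos_root n ns x - pos_root n ns a\<bar> < e"
proof -
  define z where "z = pos_root n ns a"
  have z: "0 < z" "z \<le> 1" "eqn n ns a (of_real z) = 0"
    unfolding z_def by (rule pos_root[OF a n])+
  have zp: "0 < z ^ (n - 1)"
    using z by simp
  define d where "d = e * z ^ (n - 1) / of_nat CARD('p)"
  have "d > 0"
    using zp \<open>e > 0\<close> by (simp add: d_def)
  moreover have "\<bar>pos_root n ns x - z\<bar> < e" if x: "x \<in> orthant" "x \<in> polydisc a d" for x
  proof -
    define y where "y = pos_root n ns x"
    have y: "0 < y" "eqn n ns x (of_real y) = 0"
      unfolding y_def by (rule pos_root[OF x(1) n])+
    obtain q where q: "eqn_quot n ns x (of_real y) (of_real z) = of_real q" "z ^ (n - 1) \<le> q"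
      using eqn_quot_of_real[of x y z n ns] x(1) n y z by auto
    have "of_real ((z - y) * q) = eqn n ns x (of_real z)"
      using eqn_diff[of n ns x "of_real y" "of_real z"] y q by (simp add: algebra_simps)
    also have "\<dots> = eqn n ns x (of_real z) - eqn n ns a (of_real z)"
      using z by simp
    also have "\<dots> = (\<Sum>i\<in>UNIV. (x $ i - a $ i) * of_real z ^ ns i)"
      by (simp add: eqn_def left_diff_distrib sum_subtractf)
    finally have "\<bar>(z - y) * q\<bar> = norm (\<Sum>i\<in>UNIV. (x $ i - a $ i) * complex_of_real z ^ ns i)"
      by (metis norm_of_real)
    also have "\<dots> \<le> (\<Sum>i\<in>UNIV. norm (x $ i - a $ i))"
    proof (rule sum_norm_le)
      fix i
      show "norm ((x $ i - a $ i) * complex_of_real z ^ ns i) \<le> norm (x $ i - a $ i)"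
        using z by (simp add: norm_mult norm_power mult_left_le power_le_one)
    qed
    also have "\<dots> < of_nat CARD('p) * d"
      by (rule sum_norm_polydisc[OF x(2)])
    also have "\<dots> = e * z ^ (n - 1)"
      by (simp add: d_def)
    finally have "\<bar>z - y\<bar> * \<bar>q\<bar> < e * z ^ (n - 1)"
      by (simp add: abs_mult)
    moreover have "\<bar>z - y\<bar> * z ^ (n - 1) \<le> \<bar>z - y\<bar> * \<bar>q\<bar>"
      using q(2) by (intro mult_left_mono) auto
    ultimately have "\<bar>z - y\<bar> * z ^ (n - 1) < e * z ^ (n - 1)"
      by linarith
    then show ?thesis
      using zp by (simp add: y_def abs_minus_commute)
  qed
  ultimately show ?thesis
    using that unfolding z_def by blast
qed

definition eqn_deriv :: "nat \<Rightarrow> ('p :: finite \<Rightarrow> nat) \<Rightarrow> complex ^ 'p \<Rightarrow> complex \<Rightarrow> complex" where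
  "eqn_deriv n ns x y = of_nat n * y ^ (n - 1) + (\<Sum>i\<in>UNIV. x $ i * (of_nat (ns i) * y ^ (ns i - 1)))"

lemma has_field_derivative_eqn:
  "((\<lambda>y. eqn n ns x y) has_field_derivative eqn_deriv n ns x y) (at y)"
  unfolding eqn_def eqn_deriv_def by (auto intro!: derivative_eq_intros sum.cong)

text \<open>
  Write \<open>F(x,y) = (y - z) q(y)\<close>. Then \<open>\<phi> F\<^sub>y / F = \<phi> / (y - z) + \<phi> q' / q\<close>. Cauchy's formula applies
  to the first summand, and the second is holomorphic in the disc.
\<close>

lemma eqn_root_residue:
  assumes root: "eqn n ns x z = 0"
    and near: "norm (z - z0) < \<rho>" "\<rho> < R"
    and nz: "\<And>y. y \<in> ball z0 R \<Longrightarrow> eqn_quot n ns x y z \<noteq> 0"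
    and \<phi>: "\<phi> holomorphic_on ball z0 R"
  shows "((\<lambda>y. \<phi> y * eqn_deriv n ns x y / eqn n ns x y) has_contour_integral
     2 * of_real pi * \<i> * \<phi> z) (circlepath z0 \<rho>)"
proof -
  have "\<rho> > 0"
    using near by (meson norm_ge_zero order_le_less_trans)
  define q where "q y = eqn_quot n ns x y z" for y
  have q_hol: "q holomorphic_on UNIV"
    unfolding q_def eqn_quot_def power_quot_def by (intro holomorphic_intros)
  have fac: "eqn n ns x y = (y - z) * q y" for y
    using eqn_diff[of n ns x y z] root by (simp add: q_def)
  have q': "(q has_field_derivative deriv q y) (at y)" for y
    using q_hol by (simp add: holomorphic_derivI)
  have der: "eqn_deriv n ns x y = q y + (y - z) * deriv q y" for y
  proof (rule DERIV_unique)
    show "((\<lambda>y. eqn n ns x y) has_field_derivative eqn_deriv n ns x y) (at y)"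
      by (rule has_field_derivative_eqn)
    show "((\<lambda>y. eqn n ns x y) has_field_derivative q y + (y - z) * deriv q y) (at y)"
      unfolding fac by (auto intro!: derivative_eq_intros q')
  qed
  have sub: "cball z0 \<rho> \<subseteq> ball z0 R"
    using near by auto
  have "((\<lambda>y. \<phi> y / (y - z)) has_contour_integral 2 * of_real pi * \<i> * \<phi> z) (circlepath z0 \<rho>)"
  proof (rule Cauchy_integral_circlepath)
    show "continuous_on (cball z0 \<rho>) \<phi>"
      using \<phi> sub by (blast intro: holomorphic_on_imp_continuous_on holomorphic_on_subset)
    show "\<phi> holomorphic_on ball z0 \<rho>"
      using near by (intro holomorphic_on_subset[OF \<phi>]) auto
  qed (use near in auto)
  moreover have "((\<lambda>y. \<phi> y * deriv q y / q y) has_contour_integral 0) (circlepath z0 \<rho>)"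
  proof (rule Cauchy_theorem_disc_simple)
    show "(\<lambda>y. \<phi> y * deriv q y / q y) holomorphic_on ball z0 R"
      using nz by (intro holomorphic_intros \<phi> holomorphic_on_subset[OF q_hol]
          holomorphic_on_subset[OF holomorphic_deriv[OF q_hol]]) (auto simp: q_def)
  qed (use \<open>\<rho> > 0\<close> sub in auto)
  ultimately have "((\<lambda>y. \<phi> y / (y - z) + \<phi> y * deriv q y / q y) has_contour_integral
      2 * of_real pi * \<i> * \<phi> z + 0) (circlepath z0 \<rho>)"
    by (rule has_contour_integral_add)
  then have "((\<lambda>y. \<phi> y * eqn_deriv n ns x y / eqn n ns x y) has_contour_integral
     2 * of_real pi * \<i> * \<phi> z + 0) (circlepath z0 \<rho>)"
  proof (rule has_contour_integral_eq)
    fix y assume "y \<in> path_image (circlepath z0 \<rho>)"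
    then have y: "y \<in> ball z0 R" "norm (y - z0) = \<rho>"
      using \<open>\<rho> > 0\<close> near by (auto simp: dist_norm norm_minus_commute)
    then have "q y \<noteq> 0" "y - z \<noteq> 0"
      using nz near by (auto simp: q_def)
    then show "\<phi> y / (y - z) + \<phi> y * deriv q y / q y = \<phi> y * eqn_deriv n ns x y / eqn n ns x y"
      unfolding der fac by (simp add: field_simps)
  qed
  then show ?thesis by simp
qed

lemma common_radius:
  fixes f :: "'i :: finite \<Rightarrow> complex ^ 'p :: finite \<Rightarrow> complex"
  assumes "\<And>i. \<exists>r>0. has_power_series_at (f i) a r"
  obtains r where "r > 0" "\<And>i. has_power_series_at (f i) a r"
proof -
  obtain R where R: "\<And>i. R i > 0" "\<And>i. has_power_series_at (f i) a (R i)"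
    using assms by metis
  have "Min (range R) > 0"
    using R(1) by (subst Min_gr_iff) auto
  moreover have "has_power_series_at (f i) a (Min (range R))" for i
    by (rule has_power_series_at_mono[OF R(2)]) auto
  ultimately show ?thesis
    using that by blast
qed

text \<open>
  Since \<open>F(x,y) = F(a,y) (1 - \<Sum> (x\<^sub>i - a\<^sub>i) B\<^sub>i(y))\<close> with \<open>B\<^sub>i(y) = - y^(n\<^sub>i) / F(a,y)\<close>, each summand of
  \<open>F\<^sub>y\<close> contributes to the residue integral a coordinate times an integral that is already known
  to be a power series. Continuity of the root is what keeps it inside the circle when \<open>x\<close>
  varies.
\<close>

lemma has_power_series_at_pos_root:
  fixes a :: "complex ^ 'p :: finite"
  assumes a: "a \<in> orthant" and n: "n > 0" "\<And>i. ns i > 0"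
    and \<phi>: "\<phi> holomorphic_on {y. 0 < Re y}"
  shows "\<exists>g r. r > 0 \<and> has_power_series_at g a r \<and>
    (\<forall>x\<in>orthant \<inter> polydisc a r. \<phi> (of_real (pos_root n ns x)) = g x)"
proof -
  define t where "t = pos_root n ns a"
  define z0 where "z0 = complex_of_real t"
  have t: "0 < t" "eqn n ns a z0 = 0"
    unfolding t_def z0_def by (rule pos_root[OF a n])+
  obtain e where e: "e > 0" "\<And>x y z. x \<in> polydisc a e \<Longrightarrow> norm (y - z0) < e \<Longrightarrow> norm (z - z0) < e
    \<Longrightarrow> eqn_quot n ns x y z \<noteq> 0"
    using eqn_quot_nonzero_near[OF eqn_quot_pos_root_nonzero[of a n ns, OF a n, folded t_def z0_def]]
    by metis
  \<comment> \<open>Within distance \<open>e\<close> the quotient \<open>Q\<close> does not vanish, so that \<open>F\<close> has only one root in the disc.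
    Radius at most \<open>t\<close> keeps the disc in the half-plane where \<open>\<phi>\<close> is holomorphic.\<close>
  define R where "R = min e t"
  define \<rho> where "\<rho> = R / 2"
  have R: "0 < \<rho>" "\<rho> < R" "R \<le> e" "R \<le> t"
    using e t by (auto simp: R_def \<rho>_def)
  obtain d where d: "d > 0"
    "\<And>x. x \<in> orthant \<Longrightarrow> x \<in> polydisc a d \<Longrightarrow> \<bar>pos_root n ns x - t\<bar> < \<rho>"
    using pos_root_continuous[of a n ns, OF a n R(1)] unfolding t_def by metis
  have ball_pos: "ball z0 R \<subseteq> {y. 0 < Re y}"
  proof
    fix y assume "y \<in> ball z0 R"
    then have "\<bar>Re (z0 - y)\<bar> < t"
      using abs_Re_le_cmod[of "z0 - y"] R(4) by (simp add: dist_norm)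
    then show "y \<in> {y. 0 < Re y}"
      by (simp add: z0_def)
  qed
  have \<phi>_hol: "\<phi> holomorphic_on ball z0 R"
    by (rule holomorphic_on_subset[OF \<phi> ball_pos])
  have cont: "continuous_on (sphere z0 \<rho>) \<phi>"
    using R by (intro holomorphic_on_imp_continuous_on holomorphic_on_subset[OF \<phi>_hol]) auto
  have eqn_cont: "continuous_on S (eqn n ns x)" for S x
    unfolding eqn_def by (intro continuous_intros)
  have a_self: "a \<in> polydisc a e"
    using e by (simp add: polydisc_def)
  have F0: "eqn n ns a y \<noteq> 0" if "y \<in> sphere z0 \<rho>" for y
  proof -
    have y: "norm (y - z0) = \<rho>"
      using that by (simp add: dist_norm norm_minus_commute)
    have "eqn n ns a y = (y - z0) * eqn_quot n ns a y z0"
      using eqn_diff[of n ns a y z0] t by simp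
    moreover have "eqn_quot n ns a y z0 \<noteq> 0"
      using y R e(1) by (intro e(2) a_self) auto
    ultimately show ?thesis
      using y R by auto
  qed
  define B where "B i y = - (y ^ ns i) / eqn n ns a y" for i y
  \<comment> \<open>\<open>I m\<close> collects the part of the residue integral that comes from a power \<open>y^m\<close> of \<open>F\<close>.\<close>
  define I where "I m x = contour_integral (circlepath z0 \<rho>)
      (\<lambda>y. \<phi> y * (of_nat m * y ^ (m - 1)) / eqn n ns a y / (1 - (\<Sum>i\<in>UNIV. (x $ i - a $ i) * B i y)))"
    for m and x :: "complex ^ 'p"
  have I: "\<exists>r>0. has_power_series_at (I m) a r" for m
    unfolding I_def
  proof (rule has_power_series_at_circle_integral[OF R(1)])
    show "continuous_on (sphere z0 \<rho>) (\<lambda>y. \<phi> y * (of_nat m * y ^ (m - 1)) / eqn n ns a y)"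
      using F0 by (intro continuous_intros cont eqn_cont) auto
    show "continuous_on (sphere z0 \<rho>) (B i)" for i
      unfolding B_def using F0 by (intro continuous_intros eqn_cont) auto
  qed
  obtain r0 where r0: "r0 > 0" "has_power_series_at (I n) a r0"
    using I by blast
  obtain r1 where r1: "r1 > 0" "\<And>i. has_power_series_at (I (ns i)) a r1"
    using common_radius[of "\<lambda>i. I (ns i)" a] I by metis
  define r where "r = min (min r0 r1) (min d e)"
  have r: "r > 0" "r \<le> r0" "r \<le> r1" "r \<le> d" "r \<le> e"
    using r0(1) r1(1) d(1) e(1) by (auto simp: r_def)
  define g where "g x = 1 / (2 * of_real pi * \<i>) * (I n x + (\<Sum>i\<in>UNIV. x $ i * I (ns i) x))" for x
  have "has_power_series_at g a r"
    unfolding g_def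
    by (intro has_power_series_at_cmult has_power_series_at_add has_power_series_at_sum
        has_power_series_at_mult_coord has_power_series_at_mono[OF r0(2) r(2)]
        has_power_series_at_mono[OF r1(2) r(3)])
  moreover have "\<phi> (of_real (pos_root n ns x)) = g x" if x: "x \<in> orthant \<inter> polydisc a r" for x
  proof -
    define z where "z = complex_of_real (pos_root n ns x)"
    have xd: "x \<in> polydisc a d" "x \<in> polydisc a e"
      using x polydisc_mono r(4,5) by auto
    have root: "eqn n ns x z = 0"
      unfolding z_def using pos_root[of x n ns] x n by auto
    have "norm (z - z0) = \<bar>pos_root n ns x - t\<bar>"
      unfolding z_def z0_def by (metis norm_of_real of_real_diff)
    then have near: "norm (z - z0) < \<rho>"
      using d(2)[of x] x xd by simp
    have nz: "eqn_quot n ns x y z \<noteq> 0" if "y \<in> ball z0 R" for y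
      using that near R by (intro e(2) xd) (auto simp: dist_norm norm_minus_commute)
    have Fx: "eqn n ns x y \<noteq> 0" if "y \<in> sphere z0 \<rho>" for y
    proof -
      have "eqn n ns x y = (y - z) * eqn_quot n ns x y z"
        using eqn_diff[of n ns x y z] root by simp
      moreover have "y \<noteq> z" "y \<in> ball z0 R"
        using that near R by (auto simp: dist_norm norm_minus_commute)
      ultimately show ?thesis
        using nz by simp
    qed
    have denom: "eqn n ns a y * (1 - (\<Sum>i\<in>UNIV. (x $ i - a $ i) * B i y)) = eqn n ns x y"
      if "y \<in> sphere z0 \<rho>" for y
    proof -
      have "(\<Sum>i\<in>UNIV. (x $ i - a $ i) * B i y) = - (\<Sum>i\<in>UNIV. (x $ i - a $ i) * y ^ ns i) / eqn n ns a y"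
        by (simp add: B_def sum_divide_distrib sum_negf)
      also have "(\<Sum>i\<in>UNIV. (x $ i - a $ i) * y ^ ns i) = eqn n ns x y - eqn n ns a y"
        by (simp add: eqn_def left_diff_distrib sum_subtractf)
      finally show ?thesis
        using F0[OF that] by (simp add: field_simps)
    qed
    define J where "J m y = \<phi> y * (of_nat m * y ^ (m - 1)) / eqn n ns x y" for m y
    have IJ: "(J m has_contour_integral I m x) (circlepath z0 \<rho>)" for m
    proof -
      have "J m contour_integrable_on circlepath z0 \<rho>"
        unfolding J_def using Fx R
        by (intro contour_integrable_continuous_circlepath continuous_intros)
          (auto intro!: cont eqn_cont)
      moreover have "I m x = contour_integral (circlepath z0 \<rho>) (J m)"
        unfolding I_def
      proof (rule contour_integral_eq)
        fix y assume "y \<in> path_image (circlepath z0 \<rho>)"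
        then have "y \<in> sphere z0 \<rho>"
          using R by simp
        from denom[OF this] show "\<phi> y * (of_nat m * y ^ (m - 1)) / eqn n ns a y
            / (1 - (\<Sum>i\<in>UNIV. (x $ i - a $ i) * B i y)) = J m y"
          by (simp add: J_def)
      qed
      ultimately show ?thesis
        by (simp add: has_contour_integral_integral)
    qed
    have "((\<lambda>y. J n y + (\<Sum>i\<in>UNIV. x $ i * J (ns i) y)) has_contour_integral
        I n x + (\<Sum>i\<in>UNIV. x $ i * I (ns i) x)) (circlepath z0 \<rho>)"
      by (intro has_contour_integral_add has_contour_integral_sum has_contour_integral_lmul IJ) auto
    moreover have "(\<lambda>y. J n y + (\<Sum>i\<in>UNIV. x $ i * J (ns i) y))
        = (\<lambda>y. \<phi> y * eqn_deriv n ns x y / eqn n ns x y)"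
      by (simp add: J_def eqn_deriv_def fun_eq_iff distrib_left sum_distrib_left add_divide_distrib
          sum_divide_distrib mult.left_commute)
    ultimately have "((\<lambda>y. \<phi> y * eqn_deriv n ns x y / eqn n ns x y) has_contour_integral
        I n x + (\<Sum>i\<in>UNIV. x $ i * I (ns i) x)) (circlepath z0 \<rho>)"
      by simp
    moreover have "((\<lambda>y. \<phi> y * eqn_deriv n ns x y / eqn n ns x y) has_contour_integral
        2 * of_real pi * \<i> * \<phi> z) (circlepath z0 \<rho>)"
      by (rule eqn_root_residue[OF root near R(2) nz \<phi>_hol])
    ultimately have "I n x + (\<Sum>i\<in>UNIV. x $ i * I (ns i) x) = 2 * of_real pi * \<i> * \<phi> z"
      by (rule has_contour_integral_unique)
    then show ?thesis
      by (simp add: g_def z_def)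
  qed
  ultimately show ?thesis
    using r(1) by blast
qed

lemma pos_root_power_series_analytic:
  assumes "n > 0" "\<And>i. ns i > 0"
  shows "(\<lambda>x. of_real (pos_root n ns x)) power_series_analytic_on orthant"
  using assms by (intro power_series_analytic_onI has_power_series_at_pos_root[where \<phi> = "\<lambda>y. y"])
    (auto intro: holomorphic_intros)

lemma Psi_inv_power_series_analytic:
  fixes ns :: "'p :: finite \<Rightarrow> nat"
  assumes "n > 0" "\<And>i. ns i > 0"
  shows "(\<lambda>x. Psi_inv n ns x $ i) power_series_analytic_on orthant"
proof (rule power_series_analytic_onI)
  fix a :: "complex ^ 'p" assume a: "a \<in> orthant"
  have "(\<lambda>y. 1 / y ^ (n - ns i)) holomorphic_on {y. 0 < Re y}"
    by (intro holomorphic_intros) auto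
  from has_power_series_at_pos_root[of a n ns, OF a assms this]
  obtain g r where g: "r > 0" "has_power_series_at g a r"
    "\<forall>x\<in>orthant \<inter> polydisc a r. 1 / of_real (pos_root n ns x) ^ (n - ns i) = g x"
    by blast
  show "\<exists>g r. r > 0 \<and> has_power_series_at g a r \<and> (\<forall>x\<in>orthant \<inter> polydisc a r. Psi_inv n ns x $ i = g x)"
  proof (intro exI conjI ballI)
    show "has_power_series_at (\<lambda>x. x $ i * g x) a r"
      by (rule has_power_series_at_mult_coord[OF g(2)])
    fix x assume "x \<in> orthant \<inter> polydisc a r"
    then have "g x = 1 / of_real (pos_root n ns x) ^ (n - ns i)"
      using g(3) by simp
    then show "Psi_inv n ns x $ i = x $ i * g x"
      by (simp add: Psi_inv_def)
  qed (rule g(1))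
qed

section \<open>The principal solution\<close>

lemma convex_orthant: "convex (orthant :: (complex ^ 'p :: finite) set)"
  unfolding convex_def orthant_def
  by (auto simp: complex_nonneg_Reals_iff)

text \<open>
  Let \<open>G(x) = Q(x, Z'(x), Z(x))\<close>. Since \<open>(Z' - Z) G = 0\<close>, the orthant is the union of the closed sets
  \<open>Z' = Z\<close> and \<open>G = 0\<close>. They are disjoint because \<open>Z\<close> is a simple root everywhere.
\<close>

lemma principal_solution_unique:
  fixes Z Z' :: "complex ^ 'p :: finite \<Rightarrow> complex"
  assumes "n > 0" "principal_solution n ns Z" "principal_solution n ns Z'"
    and nz: "\<And>x. x \<in> orthant \<Longrightarrow> eqn_quot n ns x (Z x) (Z x) \<noteq> 0"
    and x: "x \<in> orthant"
  shows "Z' x = Z x"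
proof -
  have cont: "continuous_on orthant Z" "continuous_on orthant Z'"
    using assms by (auto simp: principal_solution_def intro: continuous_on_power_series_analytic)
  have root: "eqn n ns x (Z x) = 0" "eqn n ns x (Z' x) = 0" if "x \<in> orthant" for x
    using assms(2,3) that by (auto simp: principal_solution_def eqn_def)
  define G where "G x = eqn_quot n ns x (Z' x) (Z x)" for x
  have G_cont: "continuous_on orthant G"
    unfolding G_def eqn_quot_def power_quot_def by (intro continuous_intros cont)
  have split: "(Z' x - Z x) * G x = 0" if "x \<in> orthant" for x
    using eqn_diff[of n ns x "Z' x" "Z x"] root[OF that] by (simp add: G_def)
  define A where "A = {x \<in> orthant. Z' x - Z x = 0}"
  define B where "B = {x \<in> orthant. G x = 0}"
  have "closedin (top_of_set orthant) A" "closedin (top_of_set orthant) B"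
    unfolding A_def B_def
    using continuous_closedin_preimage_constant[OF continuous_on_diff[OF cont(2,1)], of 0]
      continuous_closedin_preimage_constant[OF G_cont, of 0] by auto
  moreover have "orthant \<subseteq> A \<union> B"
    using split by (auto simp: A_def B_def)
  moreover have "A \<inter> B = {}"
    using nz by (auto simp: A_def B_def G_def)
  moreover have "(0 :: complex ^ 'p) \<in> A"
    using assms(2,3) by (auto simp: A_def orthant_def principal_solution_def)
  ultimately have "B = {}"
    using convex_connected[OF convex_orthant] unfolding connected_closedin by blast
  with \<open>orthant \<subseteq> A \<union> B\<close> x show ?thesis
    by (auto simp: A_def)
qed

theorem lemma3:
  fixes n :: nat and ns :: "'p :: {finite, linorder} \<Rightarrow> nat"
  assumes "\<And>i. 0 < ns i"
    and "\<And>i j. i < j \<Longrightarrow> ns j < ns i"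
    and "\<And>i. ns i < n"
  shows
    "bij_betw (Psi n ns) orthant orthant \<and>

     (Psi n ns holomorphic_map_on (- Xi) \<and>
      (\<forall>\<xi>\<in>- Xi. det (jacobian (Psi n ns) (at \<xi>)) =
         W_pow n ((\<Sum>k\<in>UNIV. int (ns k)) - int n * (int CARD('p) + 1)) \<xi> *
         (1 + 1 / of_nat n * (\<Sum>k\<in>UNIV. of_nat (ns k) * \<xi> $ k)))) \<and>

     ((\<forall>i. (\<lambda>\<xi>. Psi n ns \<xi> $ i) power_series_analytic_on orthant) \<and>
      (\<forall>i. (\<lambda>x. inv_into orthant (Psi n ns) x $ i) power_series_analytic_on orthant)) \<and>

     (let Z = W_pow n (- 1) \<circ> inv_into orthant (Psi n ns) in
        principal_solution n ns Z \<and>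
        Z ` orthant \<subseteq> complex_of_real ` {0<..1} \<and>
        (\<forall>Z'. principal_solution n ns Z' \<longrightarrow> (\<forall>x\<in>orthant. Z' x = Z x)))"
proof -
  have n: "n > 0"
    using assms(3)[of undefined] by simp
  note inv = inv_into_Psi[of n ns, OF n assms(1,3)]
  define Z where "Z = W_pow n (- 1) \<circ> inv_into orthant (Psi n ns)"
  have Z: "Z x = of_real (pos_root n ns x)" if "x \<in> orthant" for x
    using Psi_inv_orthant(2)[of _ n ns, OF that n assms(1,3)] inv[OF that]
    by (simp add: Z_def W_pow_def power_int_minus)
  have transfer: "f power_series_analytic_on orthant"
    if "g power_series_analytic_on orthant" "\<And>x. x \<in> orthant \<Longrightarrow> f x = g x"
    for f g :: "(complex, 'p) vec \<Rightarrow> complex"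
    using that by (simp add: power_series_analytic_on_def cong: imp_cong)
  have zero: "(0 :: (complex, 'p) vec) \<in> orthant"
    by (simp add: orthant_def)
  have "pos_root n ns 0 = 1"
    by (rule pos_root_eqI[OF zero n]) (auto simp: eqn_def)
  then have sol: "principal_solution n ns Z"
    unfolding principal_solution_def
    using transfer[OF pos_root_power_series_analytic[of n ns, OF n assms(1)] Z] pos_root(3)[of _ n ns, OF _ n assms(1)]
    by (auto simp: Z zero eqn_def)
  have unique: "Z' x = Z x" if "principal_solution n ns Z'" "x \<in> orthant" for Z' x
    using principal_solution_unique[OF n sol that(1) _ that(2)] eqn_quot_pos_root_nonzero[of _ n ns, OF _ n assms(1)]
    by (simp add: Z)
  have range: "Z ` orthant \<subseteq> complex_of_real ` {0<..1}"
    using pos_root(1,2)[of _ n ns, OF _ n assms(1)] by (auto simp: Z)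
  have inv_analytic: "(\<lambda>x. inv_into orthant (Psi n ns) x $ i) power_series_analytic_on orthant" for i
    by (rule transfer[OF Psi_inv_power_series_analytic[of n ns, OF n assms(1)]]) (simp add: inv)
  show ?thesis
    unfolding Let_def Z_def[symmetric]
  proof (intro conjI allI ballI impI)
    show "bij_betw (Psi n ns) orthant orthant"
      by (rule bij_betw_Psi[OF n assms(1,3)])
    show "Psi n ns holomorphic_map_on (- Xi)"
      by (rule holomorphic_Psi[OF n])
    show "det (jacobian (Psi n ns) (at \<xi>)) =
         W_pow n ((\<Sum>k\<in>UNIV. int (ns k)) - int n * (int CARD('p) + 1)) \<xi> *
         (1 + 1 / of_nat n * (\<Sum>k\<in>UNIV. of_nat (ns k) * \<xi> $ k))" if "\<xi> \<in> - Xi" for \<xi>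
      using that by (intro det_jacobian_Psi[OF n]) auto
    show "(\<lambda>\<xi>. Psi n ns \<xi> $ i) power_series_analytic_on orthant" for i
      by (rule Psi_power_series_analytic[OF n])
    show "(\<lambda>x. inv_into orthant (Psi n ns) x $ i) power_series_analytic_on orthant" for i
      by (rule inv_analytic)
    show "principal_solution n ns Z"
      by (rule sol)
    show "Z ` orthant \<subseteq> complex_of_real ` {0<..1}"
      by (rule range)
    show "Z' x = Z x" if "principal_solution n ns Z'" "x \<in> orthant" for Z' x
      by (rule unique[OF that])
  qed
qed

end
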